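(* Let $\Bbbk$ be a field of characteristic $3$, $R=\Bbbk[z_{i,j}:1\le i<j\le5]$ with the standard grading, and let $I\subset R$ be the Gorenstein ideal generated by the $4\times4$ Pfaffians of the generic $5\times5$ skew-symmetric matrix with $(i,j)$-entry $z_{i,j}$ for $i<j$ and $0$ for $i=j$. Fix a permutation $(a,b,c)$ of $(3,4,5)$ and set $$H_0=\sum_{t=1}^5Q(\eta_t)+U_{(a,b,c)},$$ with $\eta_t$, $Q$, $U_{(a,b,c)}$ as defined in the context. Consider the minimal graded free resolution of $R/I$ as an $R$-module $$F_\bullet:\quad0\to R(-5)\to R(-3)^5\to R(-2)^5\to R$$ and its third Frobenius power $$\varphi^*F_\bullet:\quad0\to R(-15)\to R(-9)^5\to R(-6)^5\to R.$$ Then there exists a chain map $\Phi^\flat_\bullet\colon\varphi^*F_\bullet\to F_\bullet$ such that $\Phi_0^\flat$ is the identity map and $\Phi_3^\flat\colon\varphi^*F_3\cong R(-15)\to R(-5)\cong F_3$ is multiplication by $H_0$.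
   Context: Convention: $z_{i,j}=-z_{j,i}$ for $j<i$. The symmetric group $\mathfrak{S}_5$ acts on $R$ by $\Bbbk$-algebra automorphisms $\sigma\cdot z_{i,j}=z_{\sigma(i),\sigma(j)}$. For a polynomial $\eta$, $Q(\eta)$ is the sum of the (distinct) elements of the $\mathfrak{S}_5$-orbit of $\eta$. The monomials are $$\eta_1=z_{1,3}z_{1,4}z_{1,5}^2z_{2,3}z_{2,4}^2z_{2,5}z_{3,4}z_{3,5},\quad\eta_2=z_{1,3}z_{1,4}z_{1,5}^2z_{2,3}z_{2,4}z_{2,5}^2z_{3,4}^2,$$ $$\eta_3=z_{1,4}^2z_{1,5}^2z_{2,3}^2z_{2,5}^2z_{3,4}^2,\quad\eta_4=z_{1,4}z_{1,5}^3z_{2,3}^2z_{2,4}z_{2,5}z_{3,4}^2,\quad\eta_5=z_{1,5}^4z_{2,3}^2z_{2,4}^2z_{3,4}^2.$$ $U_{(a,b,c)}$ is the sum of the elements of the orbit of $\theta_{(a,b,c)}=z_{2,a}^3z_{b,c}^3\prod_{i=2}^5z_{1,i}$ under the order-$20$ subgroup $\langle(1,2,a,b,c),(2,a,c,b)\rangle$ of $\mathfrak{S}_5$ (cycle notation). The third Frobenius power $\varphi^*F_\bullet$ is the complex obtained from $F_\bullet$ by replacing all entries of the matrices of the differentials by their cubes; the identifications $\varphi^*F_3\cong R(-15)$ and $F_3\cong R(-5)$ use a basis of $F_3$ and the induced basis of $\varphi^*F_3$. *)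

theory Defs
  imports
    "HOL-Library.Poly_Mapping"
    "HOL-Computational_Algebra.Computational_Algebra"
    "HOL-Algebra.Sym_Groups"
    "HOL-Algebra.Generated_Groups"
    "Jordan_Normal_Form.Matrix_Kernel"
begin

section \<open>The polynomial ring in the ten variables z(i,j), 1 <= i < j <= 5\<close>

typedef zvar = "{(i::nat, j::nat). 1 \<le> i \<and> i < j \<and> j \<le> 5}"
  by (rule exI[of _ "(1, 2)"]) simp

text \<open>Polynomials are finitely supported functions from monomials to coefficients, and
  monomials are finitely supported functions from variables to exponents; the ring structure
  (convolution product) is that of \<^theory>\<open>HOL-Library.Poly_Mapping\<close>.\<close>

type_synonym 'k zpoly = "(zvar \<Rightarrow>\<^sub>0 nat) \<Rightarrow>\<^sub>0 'k"

definition zX :: "zvar \<Rightarrow> 'k::comm_ring_1 zpoly"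
  where "zX v = Poly_Mapping.single (Poly_Mapping.single v 1) 1"

text \<open>This is also the (i,j)-entry of the generic skew-symmetric matrix. It is meaningful for
  i, j in {1..5} only.\<close>

definition z :: "nat \<Rightarrow> nat \<Rightarrow> 'k::comm_ring_1 zpoly"
  where "z i j =
    (if i < j then zX (Abs_zvar (i, j)) else if j < i then - zX (Abs_zvar (j, i)) else 0)"

definition mono_degree :: "(zvar \<Rightarrow>\<^sub>0 nat) \<Rightarrow> nat"
  where "mono_degree m = (\<Sum>v\<in>Poly_Mapping.keys m. Poly_Mapping.lookup m v)"

section \<open>The Pfaffian ideal\<close>

definition pfaffian4 :: "(nat \<Rightarrow> nat \<Rightarrow> 'r::comm_ring_1) \<Rightarrow> nat \<Rightarrow> nat \<Rightarrow> nat \<Rightarrow> nat \<Rightarrow> 'r"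
  where "pfaffian4 M i j k l = M i j * M k l - M i k * M j l + M i l * M j k"

definition ideal_generated :: "'r::comm_ring_1 set \<Rightarrow> 'r set"
  where "ideal_generated S = Modules.module.span (*) S"

lemma module_mult: "Modules.module ((*) :: 'r::comm_ring_1 \<Rightarrow> 'r \<Rightarrow> 'r)"
  by unfold_locales (simp_all add: algebra_simps)

definition pfaffian_ideal :: "'k::comm_ring_1 zpoly set"
  where "pfaffian_ideal =
    ideal_generated {pfaffian4 z i j k l | i j k l. 1 \<le> i \<and> i < j \<and> j < k \<and> k < l \<and> l \<le> 5}"

section \<open>The polynomial \<open>H\<^sub>0\<close>\<close>

text \<open>The algebra automorphism sending z(i,j) to z(\<open>\<sigma>\<close>(i),\<open>\<sigma>\<close>(j)), given by substitution.\<close>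

definition perm_act :: "(nat \<Rightarrow> nat) \<Rightarrow> 'k::comm_ring_1 zpoly \<Rightarrow> 'k zpoly"
  where "perm_act \<sigma> p = (\<Sum>m\<in>Poly_Mapping.keys p.
    Poly_Mapping.single 0 (Poly_Mapping.lookup p m) *
    (\<Prod>v\<in>Poly_Mapping.keys m.
       (case Rep_zvar v of (i, j) \<Rightarrow> z (\<sigma> i) (\<sigma> j)) ^ Poly_Mapping.lookup m v))"

text \<open>The orbit is a set, so each of its elements is counted once.\<close>

definition orbit_sum :: "(nat \<Rightarrow> nat) set \<Rightarrow> 'k::comm_ring_1 zpoly \<Rightarrow> 'k zpoly"
  where "orbit_sum G p = \<Sum>((\<lambda>\<sigma>. perm_act \<sigma> p) ` G)"

definition Q :: "'k::comm_ring_1 zpoly \<Rightarrow> 'k zpoly"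
  where "Q p = orbit_sum (carrier (sym_group 5)) p"

definition eta1 :: "'k::comm_ring_1 zpoly"
  where "eta1 = z 1 3 * z 1 4 * z 1 5 ^ 2 * z 2 3 * z 2 4 ^ 2 * z 2 5 * z 3 4 * z 3 5"

definition eta2 :: "'k::comm_ring_1 zpoly"
  where "eta2 = z 1 3 * z 1 4 * z 1 5 ^ 2 * z 2 3 * z 2 4 * z 2 5 ^ 2 * z 3 4 ^ 2"

definition eta3 :: "'k::comm_ring_1 zpoly"
  where "eta3 = z 1 4 ^ 2 * z 1 5 ^ 2 * z 2 3 ^ 2 * z 2 5 ^ 2 * z 3 4 ^ 2"

definition eta4 :: "'k::comm_ring_1 zpoly"
  where "eta4 = z 1 4 * z 1 5 ^ 3 * z 2 3 ^ 2 * z 2 4 * z 2 5 * z 3 4 ^ 2"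

definition eta5 :: "'k::comm_ring_1 zpoly"
  where "eta5 = z 1 5 ^ 4 * z 2 3 ^ 2 * z 2 4 ^ 2 * z 3 4 ^ 2"

definition theta :: "nat \<Rightarrow> nat \<Rightarrow> nat \<Rightarrow> 'k::comm_ring_1 zpoly"
  where "theta a b c = z 2 a ^ 3 * z b c ^ 3 * (\<Prod>i=2..5. z 1 i)"

definition U :: "nat \<Rightarrow> nat \<Rightarrow> nat \<Rightarrow> 'k::comm_ring_1 zpoly"
  where "U a b c = orbit_sum
    (generate (sym_group 5) {cycle_of_list [1, 2, a, b, c], cycle_of_list [2, a, c, b]})
    (theta a b c)"

definition H0 :: "nat \<Rightarrow> nat \<Rightarrow> nat \<Rightarrow> 'k::comm_ring_1 zpoly"
  where "H0 a b c = Q eta1 + Q eta2 + Q eta3 + Q eta4 + Q eta5 + U a b c"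

section \<open>Graded free complexes\<close>

text \<open>A list \<open>as\<close> of twists stands for the graded free module \<open>\<Oplus>\<^sub>i R(- as!i)\<close> of column vectors of
  length \<open>length as\<close>, its i-th basis vector having degree \<open>as!i\<close>. Homomorphisms of degree 0
  are matrices with homogeneous entries; a nonzero (i,j)-entry has degree \<open>src!j - tgt!i\<close>.\<close>

definition graded_map :: "nat list \<Rightarrow> nat list \<Rightarrow> 'k::comm_ring_1 zpoly mat \<Rightarrow> bool"
  where "graded_map src tgt A \<longleftrightarrow>
    A \<in> carrier_mat (length tgt) (length src) \<and>
    (\<forall>i<length tgt. \<forall>j<length src. \<forall>m\<in>Poly_Mapping.keys (A $$ (i, j)).
       mono_degree m + tgt ! i = src ! j)"

definition mat_image :: "'r::comm_ring_1 mat \<Rightarrow> 'r vec set"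
  where "mat_image A = (\<lambda>v. A *\<^sub>v v) ` carrier_vec (dim_col A)"

text \<open>A complex is given by the twists \<open>tw n\<close> of its modules \<open>F\<^sub>n\<close> and its differentials
  \<open>d n : F\<^sub>n\<^sub>+\<^sub>1 \<rightarrow> F\<^sub>n\<close>, for all n; a finite complex has \<open>tw n = []\<close> (the zero module) for large n,
  so that exactness in all degrees includes injectivity of the last differential.
  The condition on constant coefficients is minimality: the differentials vanish modulo the
  homogeneous maximal ideal.\<close>

definition minimal_graded_free_resolution ::
    "'k::comm_ring_1 zpoly set \<Rightarrow> (nat \<Rightarrow> nat list) \<Rightarrow> (nat \<Rightarrow> 'k zpoly mat) \<Rightarrow> bool"
    \<comment> \<open>of the cyclic module R/J, with augmentation the canonical projection\<close>
  where "minimal_graded_free_resolution J tw d \<longleftrightarrow>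
    tw 0 = [0] \<and>
    (\<forall>n. graded_map (tw (Suc n)) (tw n) (d n)) \<and>
    mat_image (d 0) = {v \<in> carrier_vec 1. v $ 0 \<in> J} \<and>
    (\<forall>n. mat_kernel (d n) = mat_image (d (Suc n))) \<and>
    (\<forall>n. \<forall>i<dim_row (d n). \<forall>j<dim_col (d n). Poly_Mapping.lookup (d n $$ (i, j)) 0 = 0)"

definition frobenius_twists :: "nat \<Rightarrow> (nat \<Rightarrow> nat list) \<Rightarrow> nat \<Rightarrow> nat list"
  where "frobenius_twists q tw n = map (\<lambda>t. q * t) (tw n)"

definition frobenius_diff :: "nat \<Rightarrow> (nat \<Rightarrow> 'r::comm_ring_1 mat) \<Rightarrow> nat \<Rightarrow> 'r mat"
  where "frobenius_diff q d n = map_mat (\<lambda>x. x ^ q) (d n)"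

definition graded_chain_map ::
    "(nat \<Rightarrow> nat list) \<Rightarrow> (nat \<Rightarrow> 'k::comm_ring_1 zpoly mat) \<Rightarrow>
     (nat \<Rightarrow> nat list) \<Rightarrow> (nat \<Rightarrow> 'k zpoly mat) \<Rightarrow> (nat \<Rightarrow> 'k zpoly mat) \<Rightarrow> bool"
  where "graded_chain_map tw d tw' d' \<Phi> \<longleftrightarrow>
    (\<forall>n. graded_map (tw n) (tw' n) (\<Phi> n)) \<and>
    (\<forall>n. d' n * \<Phi> (Suc n) = \<Phi> n * d n)"

text \<open>\<open>0 \<rightarrow> R(-5) \<rightarrow> R(-3)\<^sup>5 \<rightarrow> R(-2)\<^sup>5 \<rightarrow> R\<close>\<close>

definition pfaffian_twists :: "nat \<Rightarrow> nat list"
  where "pfaffian_twists n =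
    (if n = 0 then [0] else if n = 1 then replicate 5 2 else if n = 2 then replicate 5 3
     else if n = 3 then [5] else [])"

text \<open>Let \<open>\<Phi>\<close> be a map from the q-th Frobenius power of the free module R to R. A basis of R is a
  unit e; the basis which it induces on the Frobenius power is \<open>e ^ q\<close>. With respect to these two
  bases, \<open>\<Phi>\<close> is multiplication by h. (Replacing e by \<open>u * e\<close> multiplies h by \<open>u ^ (q - 1)\<close>, so h does
  depend on the basis.)\<close>

definition frobenius_mult_wrt ::
    "nat \<Rightarrow> 'r::comm_ring_1 \<Rightarrow> 'r mat \<Rightarrow> 'r \<Rightarrow> bool"
  where "frobenius_mult_wrt q e \<Phi> h \<longleftrightarrow>
    e dvd 1 \<and> \<Phi> *\<^sub>v vec_of_list [e ^ q] = h \<cdot>\<^sub>v vec_of_list [e]"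

end

theory Submission
  imports Defs
begin

text \<open>Write \<open>p\<^sub>i\<close> for the Pfaffian, with sign, of the generic skew matrix \<open>Z\<close> without row and column \<open>i\<close>,
and \<open>M\<^sup>[\<^sup>3\<^sup>]\<close> for the entrywise cube of a matrix. The complex of Buchsbaum and Eisenbud has the
differentials \<open>p\<close> (a row), \<open>Z\<close> and \<open>p\<^sup>T\<close>. A chain map from its third Frobenius power that is the
identity in degree 0 can start with \<open>L\<^sub>1 = diag(p\<^sub>1\<^sup>2, \<dots>, p\<^sub>5\<^sup>2)\<close>; it then needs a matrix \<open>L\<^sub>2\<close> of
sextics with \<open>Z L\<^sub>2 = L\<^sub>1 Z\<^sup>[\<^sup>3\<^sup>]\<close>, and ends with the form \<open>h\<close> of degree 10 for which
\<open>L\<^sub>2 (p\<^sup>[\<^sup>3\<^sup>])\<^sup>T = h p\<^sup>T\<close>. The column of \<open>L\<^sub>2\<close> that belongs to the first column of \<open>Z\<close> solves a linear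
system; among the solutions with the same multidegree the only freedom is to add a scalar multiple
of \<open>z\<^sub>1\<^sub>2 z\<^sub>1\<^sub>3 z\<^sub>1\<^sub>4 z\<^sub>1\<^sub>5 p\<^sup>T\<close>, which changes \<open>h\<close> by a multiple of \<open>z\<^sub>1\<^sub>2 z\<^sub>1\<^sub>3 z\<^sub>1\<^sub>4 z\<^sub>1\<^sub>5 p\<^sub>1\<^sup>3\<close>. This is the
ambiguity that the summand \<open>U\<close> of \<open>H\<^sub>0\<close> resolves. A solution with 40 monomials, together with its
rotations under the cycle (1 2 3 4 5), gives exactly \<open>h = H\<^sub>0\<close> for (a,b,c) = (3,4,5). So the heart of the
proof is two families of identities between explicit polynomials over the prime field with three
elements, \<open>lift2_identity\<close> and \<open>lift3_identity\<close>. They hold in every commutative ring in which 3 = 0, for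
every skew matrix, and are verified by normalising polynomials.

The other (a,b,c) follow by relabelling. Let \<open>\<sigma>\<close> fix 1 and 2 and send (3,4,5) to (a,b,c). The sums \<open>Q(\<eta>)\<close>
run over orbits of the whole symmetric group, and the order-20 group and the monomial that define
\<open>U\<close> for (a,b,c) are the conjugate and the translate by \<open>\<sigma>\<close> of those for (3,4,5). Hence \<open>H\<^sub>0\<close> for (a,b,c) is the
polynomial for (3,4,5) evaluated at the matrix with entries \<open>z\<^sub>\<sigma>\<^sub>i\<^sub>,\<^sub>\<sigma>\<^sub>j\<close> (\<open>H0_value\<close>). The Pfaffians of this
matrix are up to sign and order the same, so they generate the same ideal.

An arbitrary minimal resolution \<open>d\<close> with the given twists is isomorphic to this complex
(\<open>resolution_comparison\<close>). Its entries and those of the complex are homogeneous of the same degree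
in each place, so a factorisation \<open>M = D V\<close>, which the exactness of \<open>d\<close> supplies, remains true if every entry
of \<open>V\<close> is replaced by its constant term (\<open>constant_factor\<close>). This gives constant matrices \<open>B\<close> and \<open>C\<close> and a scalar \<open>g\<close>
with \<open>p = d\<^sub>0 B\<close>, \<open>B Z = d\<^sub>1 C\<close>, \<open>C p\<^sup>T = g d\<^sub>2\<close>. The entries of \<open>p\<close>, and the columns of \<open>Z\<close>, are linearly
independent over the field, which makes \<open>B\<close>, \<open>C\<close> and \<open>g\<close> invertible. The exactness of the complex of
Pfaffians is thus a consequence of the hypothesis on \<open>d\<close>.

Cubing is a ring homomorphism in characteristic 3, so the entrywise cube of matrices is
multiplicative and the chain map can be transported: \<open>B L\<^sub>1 (B\<^sup>-\<^sup>1)\<^sup>[\<^sup>3\<^sup>]\<close>, \<open>C L\<^sub>2 (C\<^sup>-\<^sup>1)\<^sup>[\<^sup>3\<^sup>]\<close> and, in the last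
place, \<open>g\<^sup>-\<^sup>2 H\<^sub>0\<close>. With respect to the basis \<open>e = g\<close> the last map is multiplication by \<open>H\<^sub>0\<close>, since
\<open>g\<^sup>-\<^sup>2 H\<^sub>0 e\<^sup>3 = H\<^sub>0 e\<close>.\<close>

section \<open>Lists of signed monomials\<close>

text \<open>The polynomials below are lists of monomials with integer coefficients. A monomial is its
list of exponents in the ten entries above the diagonal, in the order of this list. The normal form is
what makes the orbits computable: distinct lists are distinct monomials.\<close>

definition edges :: "(nat \<times> nat) list" where
  "edges = [(1,2), (1,3), (1,4), (1,5), (2,3), (2,4), (2,5), (3,4), (3,5), (4,5)]"

type_synonym signed_mono = "int \<times> nat list"

text \<open>The triple (i,j,n) stands for the n-th power of the (i,j)-entry, in either order of i and j.\<close>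

type_synonym edge_power = "nat \<times> nat \<times> nat"

definition skew :: "(nat \<Rightarrow> nat \<Rightarrow> 'r::comm_ring_1) \<Rightarrow> bool" where
  "skew x \<longleftrightarrow> (\<forall>i. x i i = 0) \<and> (\<forall>i j. x j i = - x i j)"

definition sm_value :: "(nat \<Rightarrow> nat \<Rightarrow> 'r::comm_ring_1) \<Rightarrow> signed_mono \<Rightarrow> 'r" where
  "sm_value x t = of_int (fst t) * prod_list (map2 (\<lambda>(i,j) n. x i j ^ n) edges (snd t))"

definition value_of :: "(nat \<Rightarrow> nat \<Rightarrow> 'r::comm_ring_1) \<Rightarrow> signed_mono list \<Rightarrow> 'r" where
  "value_of x p = sum_list (map (sm_value x) p)"

text \<open>Products of exponent lists of unequal length would be truncated, so the length is tracked.\<close>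

definition wf_poly :: "signed_mono list \<Rightarrow> bool" where
  "wf_poly p \<longleftrightarrow> (\<forall>t\<in>set p. length (snd t) = 10)"

definition sm_mult :: "signed_mono \<Rightarrow> signed_mono \<Rightarrow> signed_mono" where
  "sm_mult s t = (fst s * fst t, map2 (+) (snd s) (snd t))"

definition sm_power :: "nat \<Rightarrow> nat \<Rightarrow> nat \<Rightarrow> signed_mono" where
  "sm_power i j n =
    (if i < j then 1 else (-1) ^ n, map (\<lambda>e. if e = (i, j) \<or> e = (j, i) then n else 0) edges)"

fun sm_of :: "edge_power list \<Rightarrow> signed_mono" where
  "sm_of [] = (1, replicate 10 0)"
| "sm_of ((i, j, n) # l) = sm_mult (sm_power i j n) (sm_of l)"

primrec poly_mult :: "signed_mono list \<Rightarrow> signed_mono list \<Rightarrow> signed_mono list" where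
  "poly_mult [] q = []"
| "poly_mult (s # p) q = map (sm_mult s) q @ poly_mult p q"

definition poly_neg :: "signed_mono list \<Rightarrow> signed_mono list" where
  "poly_neg p = map (\<lambda>(c, e). (- c, e)) p"

definition poly_var :: "nat \<Rightarrow> nat \<Rightarrow> signed_mono list" where
  "poly_var i j = (if i = j then [] else [sm_power i j 1])"

definition poly_pf4 :: "nat \<Rightarrow> nat \<Rightarrow> nat \<Rightarrow> nat \<Rightarrow> signed_mono list" where
  "poly_pf4 i j k l = poly_mult (poly_var i j) (poly_var k l)
     @ poly_neg (poly_mult (poly_var i k) (poly_var j l)) @ poly_mult (poly_var i l) (poly_var j k)"

definition edge_value :: "(nat \<Rightarrow> nat \<Rightarrow> 'r::comm_ring_1) \<Rightarrow> edge_power list \<Rightarrow> 'r" where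
  "edge_value x l = prod_list (map (\<lambda>(i, j, n). x i j ^ n) l)"

definition is_edge_list :: "edge_power list \<Rightarrow> bool" where
  "is_edge_list l \<longleftrightarrow> (\<forall>(i, j, n)\<in>set l. i \<noteq> j \<and> i \<in> {1..5} \<and> j \<in> {1..5})"

fun relabel :: "(nat \<Rightarrow> nat) \<Rightarrow> edge_power list \<Rightarrow> edge_power list" where
  "relabel f [] = []"
| "relabel f ((i, j, n) # l) = (f i, f j, n) # relabel f l"

lemma length_edges [simp]: "length edges = 10"
  by (simp add: edges_def)

lemma prod_list_power_add:
  fixes f :: "'a \<Rightarrow> 'r::comm_monoid_mult"
  assumes "length ps = length e" "length e = length e'"
  shows "prod_list (map2 (\<lambda>p n. f p ^ n) ps (map2 (+) e e')) =
    prod_list (map2 (\<lambda>p n. f p ^ n) ps e) * prod_list (map2 (\<lambda>p n. f p ^ n) ps e')"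
  using assms by (induction ps e e' rule: list_induct3) (simp_all add: power_add mult_ac)

lemma sm_value_mult:
  assumes "length (snd s) = 10" "length (snd t) = 10"
  shows "sm_value x (sm_mult s t) = sm_value x s * sm_value x t"
proof -
  have "prod_list (map2 (\<lambda>(i,j) n. x i j ^ n) edges (map2 (+) (snd s) (snd t))) =
      prod_list (map2 (\<lambda>(i,j) n. x i j ^ n) edges (snd s)) *
      prod_list (map2 (\<lambda>(i,j) n. x i j ^ n) edges (snd t))"
    using prod_list_power_add[of edges "snd s" "snd t" "\<lambda>p. x (fst p) (snd p)"] assms
    by (simp add: case_prod_unfold)
  then show ?thesis
    by (simp add: sm_value_def sm_mult_def)
qed

lemma length_sm_mult [simp]:
  "length (snd (sm_mult s t)) = min (length (snd s)) (length (snd t))"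
  by (simp add: sm_mult_def)

lemma length_sm_power [simp]: "length (snd (sm_power i j n)) = 10"
  by (simp add: sm_power_def)

lemma length_sm_of [simp]: "length (snd (sm_of l)) = 10"
  by (induction l rule: sm_of.induct) simp_all

lemma wf_polyI [simp]:
  "wf_poly []"
  "wf_poly (t # p) \<longleftrightarrow> length (snd t) = 10 \<and> wf_poly p"
  "wf_poly (p @ q) \<longleftrightarrow> wf_poly p \<and> wf_poly q"
  "wf_poly p \<Longrightarrow> wf_poly (poly_neg p)"
  "wf_poly (poly_var i j)"
  by (auto simp: wf_poly_def poly_neg_def poly_var_def)

lemma wf_poly_mult [simp]: "wf_poly p \<Longrightarrow> wf_poly q \<Longrightarrow> wf_poly (poly_mult p q)"
  by (induction p) (auto simp: wf_poly_def)

lemma wf_poly_pf4 [simp]: "wf_poly (poly_pf4 i j k l)"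
  by (simp add: poly_pf4_def)

lemma skewD: "skew x \<Longrightarrow> x i i = 0" "skew x \<Longrightarrow> x j i = - x i j"
  unfolding skew_def by blast+

lemma edgeI:
  assumes "i \<in> {1..5}" "j \<in> {1..5}" "i < j"
  shows "(i, j) \<in> set edges"
proof -
  have "i \<in> {1, 2, 3, 4, 5}" "j \<in> {1, 2, 3, 4, 5}"
    using assms by simp_all presburger+
  then show ?thesis
    using assms(3) by (simp add: edges_def) presburger
qed

lemma sm_value_power_edge:
  assumes "(i, j) \<in> set edges"
  shows "sm_value x (sm_power i j n) = x i j ^ n"
    and "sm_value x (sm_power j i n) = (-1) ^ n * x i j ^ n"
  using assms unfolding edges_def set_simps insert_iff
  by (elim disjE; simp add: sm_value_def sm_power_def edges_def)+

lemma sm_value_power: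
  assumes x: "skew x" and ij: "i \<noteq> j" "i \<in> {1..5}" "j \<in> {1..5}"
  shows "sm_value x (sm_power i j n) = x i j ^ n"
proof (cases "i < j")
  case True
  then show ?thesis
    using sm_value_power_edge(1)[OF edgeI] ij by blast
next
  case False
  then have "sm_value x (sm_power i j n) = (-1) ^ n * x j i ^ n"
    using sm_value_power_edge(2)[OF edgeI] ij by (meson linorder_neqE_nat)
  also have "\<dots> = x i j ^ n"
    using skewD(2)[OF x, of i j] by (metis power_minus)
  finally show ?thesis .
qed

lemma sm_value_one: "sm_value x (1, replicate 10 0) = 1"
  by (simp add: sm_value_def edges_def eval_nat_numeral)

lemma sm_value_sm_of:
  assumes x: "skew x" and l: "is_edge_list l"
  shows "sm_value x (sm_of l) = edge_value x l"
  using l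
  by (induction l rule: sm_of.induct)
    (simp_all add: x sm_value_one sm_value_mult sm_value_power edge_value_def is_edge_list_def)

lemma edge_value_relabel: "edge_value x (relabel f l) = edge_value (\<lambda>i j. x (f i) (f j)) l"
  by (induction f l rule: relabel.induct) (simp_all add: edge_value_def)

text \<open>Together with the fact that 1 and -1 differ, this makes orbit elements with different normal
forms different polynomials.\<close>

lemma sm_of_sign: "fst (sm_of l) = 1 \<or> fst (sm_of l) = -1"
proof (induction l rule: sm_of.induct)
  case (2 i j n l)
  have "fst (sm_power i j n) = 1 \<or> fst (sm_power i j n) = -1"
    by (simp add: sm_power_def minus_one_power_iff)
  then show ?case
    using 2 by (auto simp: sm_mult_def)
qed simp

lemma value_of_simps [simp]:
  "value_of x [] = 0"
  "value_of x (t # p) = sm_value x t + value_of x p"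
  "value_of x (p @ q) = value_of x p + value_of x q"
  by (simp_all add: value_of_def)

lemma value_of_mult:
  assumes "wf_poly p" "wf_poly q"
  shows "value_of x (poly_mult p q) = value_of x p * value_of x q"
proof -
  have *: "value_of x (map (sm_mult s) q) = sm_value x s * value_of x q"
    if "length (snd s) = 10" for s
    using assms(2)
    by (induction q) (simp_all add: that sm_value_mult distrib_left)
  show ?thesis
    using assms(1)
    by (induction p) (simp_all add: * distrib_right)
qed

lemma value_of_neg: "value_of x (poly_neg p) = - value_of x p"
  by (induction p) (auto simp: poly_neg_def sm_value_def)

lemma value_of_var:
  assumes "skew x" "i \<in> {1..5}" "j \<in> {1..5}"
  shows "value_of x (poly_var i j) = x i j"
  using assms by (simp add: poly_var_def sm_value_power skewD(1))

lemma value_of_pf4: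
  assumes "skew x" "i \<in> {1..5}" "j \<in> {1..5}" "k \<in> {1..5}" "l \<in> {1..5}"
  shows "value_of x (poly_pf4 i j k l) = pfaffian4 x i j k l"
  using assms by (simp add: poly_pf4_def pfaffian4_def value_of_mult value_of_neg value_of_var)

section \<open>Characteristic three\<close>

lemma cube_add:
  fixes a b :: "'r::comm_ring_1"
  assumes "(3::'r) = 0"
  shows "(a + b) ^ 3 = a ^ 3 + b ^ 3"
proof -
  have "(a + b) ^ 3 = a ^ 3 + b ^ 3 + 3 * (a * a * b + a * b * b)"
    by (simp add: power3_eq_cube algebra_simps)
  then show ?thesis by (simp add: assms)
qed

lemma of_int_eq_0_mod_3:
  assumes "(3::'r::comm_ring_1) = 0" "c mod 3 = 0"
  shows "(of_int c :: 'r) = 0"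
proof -
  obtain k where "c = 3 * k" using assms(2) by auto
  then show ?thesis using assms(1) by simp
qed

section \<open>Polynomials modulo three as trees\<close>

text \<open>Horner form: \<open>Br t u\<close> is \<open>t + x u\<close>, where \<open>x\<close> is the first variable and \<open>t\<close> does not contain it; a leaf
is a constant in any set of variables. Unlike a list of monomials, such a tree is shallow: its depth is at
most the degree plus the number of variables, which keeps normalisation by rewriting cheap.\<close>

datatype ptree = Leaf int | Br ptree ptree

primrec tvalue :: "(nat \<Rightarrow> 'r::comm_ring_1) \<Rightarrow> ptree \<Rightarrow> 'r" where
  "tvalue f (Leaf c) = of_int c"
| "tvalue f (Br t u) = tvalue (\<lambda>k. f (Suc k)) t + f 0 * tvalue f u"

fun tree_add :: "ptree \<Rightarrow> ptree \<Rightarrow> ptree" where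
  "tree_add (Leaf a) (Leaf b) = Leaf ((a + b) mod 3)"
| "tree_add (Leaf a) (Br t u) = Br (tree_add (Leaf a) t) u"
| "tree_add (Br t u) (Leaf b) = Br (tree_add t (Leaf b)) u"
| "tree_add (Br t u) (Br t' u') = Br (tree_add t t') (tree_add u u')"

primrec tree_scale :: "int \<Rightarrow> ptree \<Rightarrow> ptree" where
  "tree_scale a (Leaf b) = Leaf (a * b mod 3)"
| "tree_scale a (Br t u) = Br (tree_scale a t) (tree_scale a u)"

function tree_mult :: "ptree \<Rightarrow> ptree \<Rightarrow> ptree" where
  "tree_mult (Leaf a) q = (if a = 0 then Leaf 0 else tree_scale a q)"
| "tree_mult (Br t u) (Leaf b) = (if b = 0 then Leaf 0 else tree_scale b (Br t u))"
| "tree_mult (Br t u) (Br t' u') = Br (tree_mult t t')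
     (tree_add (tree_mult (Br t (Leaf 0)) u')
       (tree_add (tree_mult u (Br t' (Leaf 0))) (Br (Leaf 0) (tree_mult u u'))))"
  by pat_completeness auto
termination
proof (relation "measure (\<lambda>(p, q). size p + size q)")
  have *: "size (Leaf 0) \<le> size t" for t :: ptree
    by (induction t) auto
  fix t u t' u' :: ptree
  show "((Br t (Leaf 0), u'), (Br t u, Br t' u')) \<in> measure (\<lambda>(p, q). size p + size q)"
    using *[of u] by simp
  show "((u, Br t' (Leaf 0)), (Br t u, Br t' u')) \<in> measure (\<lambda>(p, q). size p + size q)"
    using *[of u'] by simp
qed simp_all

primrec tree_mono :: "int \<Rightarrow> nat list \<Rightarrow> ptree" where
  "tree_mono c [] = Leaf c"
| "tree_mono c (n # e) = (Br (Leaf 0) ^^ n) (Br (tree_mono c e) (Leaf 0))"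

fun tree_of :: "signed_mono list \<Rightarrow> ptree" where
  "tree_of [] = Leaf 0"
| "tree_of ((c, e) # p) = tree_add (tree_mono c e) (tree_of p)"

primrec tree_zero :: "ptree \<Rightarrow> bool" where
  "tree_zero (Leaf c) \<longleftrightarrow> c mod 3 = 0"
| "tree_zero (Br t u) \<longleftrightarrow> tree_zero t \<and> tree_zero u"

fun tree_dot :: "ptree list \<Rightarrow> ptree list \<Rightarrow> ptree" where
  "tree_dot (p # ps) (q # qs) = tree_add (tree_mult p q) (tree_dot ps qs)"
| "tree_dot _ _ = Leaf 0"

definition tree_eq :: "ptree \<Rightarrow> ptree \<Rightarrow> bool" where
  "tree_eq p q \<longleftrightarrow> tree_zero (tree_add p (tree_scale (-1) q))"

definition tree_value :: "(nat \<Rightarrow> nat \<Rightarrow> 'r::comm_ring_1) \<Rightarrow> ptree \<Rightarrow> 'r" where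
  "tree_value x = tvalue (\<lambda>k. x (fst (edges ! k)) (snd (edges ! k)))"

lemma of_int_mod_3:
  assumes "(3::'r::comm_ring_1) = 0"
  shows "(of_int (a mod 3) :: 'r) = of_int a"
proof -
  have "(of_int a :: 'r) = of_int (a mod 3 + 3 * (a div 3))"
    by simp
  also have "\<dots> = of_int (a mod 3)"
    unfolding of_int_add of_int_mult using assms by simp
  finally show ?thesis by simp
qed

context
  assumes char3: "(3::'r::comm_ring_1) = 0"
begin

lemma tvalue_add: "tvalue f (tree_add p q) = (tvalue f p + tvalue f q :: 'r)"
  by (induction p q arbitrary: f rule: tree_add.induct)
    (simp_all add: of_int_mod_3[OF char3] algebra_simps)

lemma tvalue_scale: "tvalue f (tree_scale a p) = (of_int a * tvalue f p :: 'r)"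
  by (induction p arbitrary: f) (simp_all add: of_int_mod_3[OF char3] algebra_simps)

lemma tvalue_mult: "tvalue f (tree_mult p q) = (tvalue f p * tvalue f q :: 'r)"
  by (induction p q arbitrary: f rule: tree_mult.induct)
    (simp_all add: tvalue_add tvalue_scale algebra_simps)

text \<open>A list of length n serves as the first n variables of the infinite supply that
\<open>tvalue\<close> expects.\<close>

lemma tvalue_mono:
  assumes "length ps = length e"
  shows "tvalue (\<lambda>k. g (ps ! k)) (tree_mono c e) =
    (of_int c * prod_list (map2 (\<lambda>p n. g p ^ n) ps e) :: 'r)"
  using assms
proof (induction ps e rule: list_induct2)
  case (Cons p ps n e)
  have "tvalue f ((Br (Leaf 0) ^^ n) t) = f 0 ^ n * tvalue f t" for f :: "nat \<Rightarrow> 'r" and t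
    by (induction n) (simp_all add: mult.assoc)
  then show ?case
    using Cons.IH by (simp add: algebra_simps)
qed simp

lemma tree_value_add: "tree_value x (tree_add p q) = (tree_value x p + tree_value x q :: 'r)"
  and tree_value_mult: "tree_value x (tree_mult p q) = (tree_value x p * tree_value x q :: 'r)"
  by (simp_all add: tree_value_def tvalue_add tvalue_mult)

lemma tree_value_of: "wf_poly p \<Longrightarrow> tree_value x (tree_of p) = (value_of x p :: 'r)"
proof (induction p)
  case (Cons t p)
  obtain c e where t: "t = (c, e)" by (cases t)
  have "tree_value x (tree_mono c e) = sm_value x t"
    using Cons.prems tvalue_mono[of edges e "\<lambda>p. x (fst p) (snd p)" c]
    by (simp add: t tree_value_def sm_value_def case_prod_unfold)
  then show ?case
    using Cons by (simp add: t tree_value_add)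
qed (simp add: tree_value_def)

lemma tree_value_dot:
  "tree_value x (tree_dot (map p [1..<6]) (map q [1..<6])) =
    (\<Sum>k = 1..5. tree_value x (p k) * tree_value x (q k) :: 'r)"
proof -
  have "tree_value x (tree_dot (map p ks) (map q ks)) =
      sum_list (map (\<lambda>k. tree_value x (p k) * tree_value x (q k) :: 'r) ks)" for ks
    by (induction ks) (simp_all add: tree_value_add tree_value_mult, simp add: tree_value_def)
  moreover have "{1..<6} = {1..5::nat}" by auto
  ultimately show ?thesis
    by (simp add: interv_sum_list_conv_sum_set_nat)
qed

lemma tvalue_zero: "tree_zero p \<Longrightarrow> tvalue f p = (0::'r)"
  by (induction p arbitrary: f) (simp_all add: of_int_eq_0_mod_3[OF char3])

lemma tree_value_eq: "tree_eq p q \<Longrightarrow> tree_value x p = (tree_value x q :: 'r)"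
  using tvalue_zero[of "tree_add p (tree_scale (-1) q)"]
  by (simp add: tree_eq_def tree_value_def tvalue_add tvalue_scale)

end

section \<open>The explicit lift and the explicit orbits\<close>

text \<open>The rotation by k of the vertices 1, ..., 5 of a pentagon.\<close>

definition rot :: "nat \<Rightarrow> nat \<Rightarrow> nat" where
  "rot k i = Suc ((i + k - 1) mod 5)"

text \<open>Listing the four remaining vertices in cyclic order builds in the sign
\<open>(-1)\<^sup>i\<^sup>+\<^sup>1\<close>, because a 5-cycle is even.\<close>

definition poly_pf :: "nat \<Rightarrow> signed_mono list" where
  "poly_pf i = poly_pf4 (rot 1 i) (rot 2 i) (rot 3 i) (rot 4 i)"

text \<open>The first column of \<open>L\<^sub>2\<close>. In row i the degree of the vertex 1 is 5, that of i is 1 and the others are 2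
(for i = 1, the vertex 1 has degree 4). The solutions with these multidegrees differ by multiples
of \<open>z\<^sub>1\<^sub>2 z\<^sub>1\<^sub>3 z\<^sub>1\<^sub>4 z\<^sub>1\<^sub>5 p\<^sub>i\<close>, with the same scalar in every row; this one belongs to (a,b,c) = (3,4,5).\<close>

definition lift_column :: "signed_mono list list" where
  "lift_column = [
   [
    (1, [2,2,0,0,0,0,0,0,0,2]),
    (1, [2,1,1,0,0,0,0,0,1,1]),
    (-1, [2,1,0,1,0,0,0,1,0,1]),
    (1, [2,0,2,0,0,0,0,0,2,0]),
    (1, [2,0,1,1,0,0,0,1,1,0]),
    (1, [2,0,0,2,0,0,0,2,0,0]),
    (1, [1,2,1,0,0,0,1,0,0,1]),
    (-1, [1,2,0,1,0,1,0,0,0,1]),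
    (1, [1,1,2,0,0,0,1,0,1,0]),
    (1, [1,1,1,1,1,0,0,0,0,1]),
    (1, [1,1,1,1,0,1,0,0,1,0]),
    (1, [1,1,0,2,0,1,0,1,0,0]),
    (-1, [1,0,2,1,1,0,0,0,1,0]),
    (-1, [1,0,1,2,1,0,0,1,0,0]),
    (1, [0,2,2,0,0,0,2,0,0,0]),
    (1, [0,2,1,1,0,1,1,0,0,0]),
    (1, [0,2,0,2,0,2,0,0,0,0]),
    (1, [0,1,2,1,1,0,1,0,0,0]),
    (1, [0,1,1,2,1,1,0,0,0,0]),
    (1, [0,0,2,2,2,0,0,0,0,0])],
   [
    (-1, [1,2,1,1,0,0,0,0,0,1]),
    (-1, [1,1,2,1,0,0,0,0,1,0]),
    (-1, [0,2,2,1,0,0,1,0,0,0]),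
    (-1, [0,2,1,2,0,1,0,0,0,0]),
    (-1, [0,1,2,2,1,0,0,0,0,0])],
   [
    (1, [2,1,1,1,0,0,0,0,0,1]),
    (-1, [2,0,2,1,0,0,0,0,1,0]),
    (-1, [2,0,1,2,0,0,0,1,0,0]),
    (-1, [1,1,1,2,0,1,0,0,0,0]),
    (1, [1,0,2,2,1,0,0,0,0,0])],
   [
    (-1, [2,2,0,1,0,0,0,0,0,1]),
    (1, [2,1,1,1,0,0,0,0,1,0]),
    (1, [2,1,0,2,0,0,0,1,0,0]),
    (1, [1,2,0,2,0,1,0,0,0,0]),
    (-1, [1,1,1,2,1,0,0,0,0,0])],
   [
    (1, [2,2,1,0,0,0,0,0,0,1]),
    (1, [2,1,2,0,0,0,0,0,1,0]),
    (1, [1,2,2,0,0,0,1,0,0,0]),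
    (1, [1,2,1,1,0,1,0,0,0,0]),
    (1, [1,1,2,1,1,0,0,0,0,0])]
  ]"

fun edge_powers :: "(nat \<times> nat) list \<Rightarrow> nat list \<Rightarrow> edge_power list" where
  "edge_powers ((i, j) # es) (n # ns) =
     (if n = 0 then edge_powers es ns else (i, j, n) # edge_powers es ns)"
| "edge_powers _ _ = []"

fun poly_relabel :: "(nat \<Rightarrow> nat) \<Rightarrow> signed_mono list \<Rightarrow> signed_mono list" where
  "poly_relabel f [] = []"
| "poly_relabel f ((c, e) # p) =
     sm_mult (c, replicate 10 0) (sm_of (relabel f (edge_powers edges e))) # poly_relabel f p"

text \<open>The rotations are even permutations under which \<open>H\<^sub>0\<close> for (3,4,5) is invariant, so one column
determines the others.\<close>

definition lift2 :: "nat \<Rightarrow> nat \<Rightarrow> signed_mono list" where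
  "lift2 i j = poly_relabel (rot (j - 1)) (lift_column ! ((i + 5 - j) mod 5))"

text \<open>A list of values on 1, ..., n, extended by the identity.\<close>

definition as_fun :: "nat list \<Rightarrow> nat \<Rightarrow> nat" where
  "as_fun l i = (if 1 \<le> i \<and> i \<le> length l then l ! (i - 1) else i)"

definition perms5 :: "nat list list" where
  "perms5 = [[a, b, c, d, e]. a \<leftarrow> [1..<6], b \<leftarrow> [1..<6], b \<noteq> a, c \<leftarrow> [1..<6], c \<noteq> a \<and> c \<noteq> b,
     d \<leftarrow> [1..<6], d \<noteq> a \<and> d \<noteq> b \<and> d \<noteq> c,
     e \<leftarrow> [1..<6], e \<noteq> a \<and> e \<noteq> b \<and> e \<noteq> c \<and> e \<noteq> d]"

text \<open>The order-20 group for (a,b,c) = (3,4,5), as products of powers of its two generators; it is the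
group of affine maps of the integers modulo 5.\<close>

definition affine5 :: "nat list list" where
  "affine5 = [(map (as_fun [2,3,4,5,1]) ^^ k) ((map (as_fun [1,3,5,2,4]) ^^ j) [1,2,3,4,5]).
     k \<leftarrow> [0..<5], j \<leftarrow> [0..<4]]"

definition orbit_sm :: "edge_power list \<Rightarrow> nat list \<Rightarrow> signed_mono" where
  "orbit_sm l p = sm_of (relabel (as_fun p) l)"

definition orbit_list :: "nat list list \<Rightarrow> edge_power list \<Rightarrow> signed_mono list" where
  "orbit_list G l = remdups (map (orbit_sm l) G)"

definition eta_edges :: "edge_power list list" where
  "eta_edges =
    [[(1,3,1), (1,4,1), (1,5,2), (2,3,1), (2,4,2), (2,5,1), (3,4,1), (3,5,1)],
     [(1,3,1), (1,4,1), (1,5,2), (2,3,1), (2,4,1), (2,5,2), (3,4,2)],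
     [(1,4,2), (1,5,2), (2,3,2), (2,5,2), (3,4,2)],
     [(1,4,1), (1,5,3), (2,3,2), (2,4,1), (2,5,1), (3,4,2)],
     [(1,5,4), (2,3,2), (2,4,2), (3,4,2)]]"

text \<open>The monomial \<open>\<theta>\<close> for (a,b,c) = (3,4,5).\<close>

definition theta_edges :: "edge_power list" where
  "theta_edges = [(2,3,3), (4,5,3), (1,2,1), (1,3,1), (1,4,1), (1,5,1)]"

definition poly_H :: "signed_mono list" where
  "poly_H = concat (map (orbit_list perms5) eta_edges) @ orbit_list affine5 theta_edges"

definition homog_poly :: "nat \<Rightarrow> signed_mono list \<Rightarrow> bool" where
  "homog_poly n p \<longleftrightarrow> list_all (\<lambda>t. length (snd t) = 10 \<and> sum_list (snd t) = n) p"

definition poly_coeff :: "signed_mono list \<Rightarrow> nat list \<Rightarrow> int" where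
  "poly_coeff p e = sum_list (map fst (filter (\<lambda>t. snd t = e) p))"

definition var_tree :: "nat \<Rightarrow> nat \<Rightarrow> ptree" where
  "var_tree i j = tree_of (poly_var i j)"

definition pf_tree :: "nat \<Rightarrow> ptree" where
  "pf_tree i = tree_of (poly_pf i)"

definition lift2_tree :: "nat \<Rightarrow> nat \<Rightarrow> ptree" where
  "lift2_tree j i = tree_of (lift2 i j)"

definition tree_cube :: "ptree \<Rightarrow> ptree" where
  "tree_cube p = tree_mult p (tree_mult p p)"

definition lift2_row_tree :: "nat \<Rightarrow> nat \<Rightarrow> ptree" where
  "lift2_row_tree i j = tree_of (lift2 i j)"

definition pf_cube_tree :: "nat \<Rightarrow> ptree" where
  "pf_cube_tree j = tree_cube (pf_tree j)"

definition syzygy_check :: "nat \<Rightarrow> bool" where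
  "syzygy_check i \<longleftrightarrow> tree_zero (tree_dot (map (var_tree i) [1..<6]) (map pf_tree [1..<6]))"

definition lift2_entry_check :: "ptree list \<Rightarrow> nat \<Rightarrow> nat \<Rightarrow> bool" where
  "lift2_entry_check ps j i \<longleftrightarrow> tree_eq (tree_dot (map (var_tree i) [1..<6]) ps)
     (tree_mult (tree_mult (pf_tree i) (pf_tree i)) (tree_cube (var_tree i j)))"

definition lift2_column_check :: "nat \<Rightarrow> bool" where
  "lift2_column_check j \<longleftrightarrow>
     list_all (lift2_entry_check (map (lift2_tree j) [1..<6]) j) [1..<6]"

definition lift3_check :: "ptree \<Rightarrow> nat \<Rightarrow> bool" where
  "lift3_check H i \<longleftrightarrow>
     tree_eq (tree_dot (map (lift2_row_tree i) [1..<6]) (map pf_cube_tree [1..<6]))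
       (tree_mult (pf_tree i) H)"

text \<open>All properties of \<open>poly_H\<close> in one predicate, so that its 152 monomials are computed only once.\<close>

definition poly_H_check :: "signed_mono list \<Rightarrow> bool" where
  "poly_H_check H \<longleftrightarrow> homog_poly 10 H \<and> list_all (lift3_check (tree_of H)) [1..<6]"

text \<open>A Pfaffian on four vertices depends, up to sign, only on the vertex m that is left out.\<close>

definition pf4_check :: "nat list \<Rightarrow> bool" where
  "pf4_check l \<longleftrightarrow> (let p = tree_of (poly_pf4 (l ! 0) (l ! 1) (l ! 2) (l ! 3)); q = pf_tree (l ! 4)
     in tree_eq p q \<or> tree_eq p (tree_scale (-1) q))"

definition homog_lift2_row :: "nat \<Rightarrow> bool" where
  "homog_lift2_row i \<longleftrightarrow> list_all (homog_poly 6) (map (lift2 i) [1..<6])"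

text \<open>The first monomial of each \<open>p\<^sub>i\<close> does not occur in the other Pfaffians. This is what makes them
linearly independent.\<close>

definition pf_coeff_row :: "nat \<Rightarrow> bool" where
  "pf_coeff_row i \<longleftrightarrow> map (\<lambda>p. poly_coeff p (snd (hd (poly_pf i)))) (map poly_pf [1..<6]) =
     (replicate 5 0)[i - 1 := fst (hd (poly_pf i))]"

text \<open>The columns of \<open>Z\<close> are independent already because each has a variable in a row (here the next
one) whose other entries are zero or different variables.\<close>

definition var_coeff_row :: "nat \<Rightarrow> bool" where
  "var_coeff_row i \<longleftrightarrow>
     map (\<lambda>p. poly_coeff p (snd (sm_power (rot 1 i) i 1))) (map (poly_var (rot 1 i)) [1..<6]) =
     (replicate 5 0)[i - 1 := fst (sm_power (rot 1 i) i 1)]"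

definition affine5_closed_at :: "nat list \<Rightarrow> bool" where
  "affine5_closed_at l \<longleftrightarrow> list_all (\<lambda>m. m \<in> set affine5) (map (map (as_fun l)) affine5)
     \<and> [1,2,3,4,5] \<in> set (map (map (as_fun l)) affine5)"

lemma syzygy_checked: "list_all syzygy_check [1..<6]"
  by code_simp

lemma lift2_checked: "list_all lift2_column_check [1..<6]"
  by code_simp

lemma homog_lift2_checked: "list_all homog_lift2_row [1..<6]"
  by code_simp

lemma homog_pf_checked: "list_all (homog_poly 2) (map poly_pf [1..<6])"
  by code_simp

lemma pf_coeff_checked: "list_all pf_coeff_row [1..<6]"
  by code_simp

lemma pf_hd_checked:
  "list_all (\<lambda>p. p \<noteq> [] \<and> (fst (hd p) = 1 \<or> fst (hd p) = -1)) (map poly_pf [1..<6])"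
  by code_simp

lemma var_coeff_checked: "list_all var_coeff_row [1..<6]"
  by code_simp

lemma pf4_checked: "list_all pf4_check perms5"
  by code_simp

lemma affine5_perms: "list_all (\<lambda>l. l \<in> set perms5) affine5"
  by code_simp

lemma affine5_closed_checked: "list_all affine5_closed_at affine5"
  by code_simp

lemma poly_H_checked: "poly_H_check poly_H"
  by code_simp

section \<open>Grading\<close>

abbreviation const :: "'k::comm_ring_1 \<Rightarrow> 'k zpoly" where
  "const \<equiv> Poly_Mapping.single 0"

lemma finite_UNIV_zvar [simp]: "finite (UNIV :: zvar set)"
proof -
  have "finite {(i::nat, j::nat). 1 \<le> i \<and> i < j \<and> j \<le> 5}"
    by (rule finite_subset[of _ "{..5} \<times> {..5}"]) auto
  then have "finite (Abs_zvar ` {(i::nat, j::nat). 1 \<le> i \<and> i < j \<and> j \<le> 5})"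
    by (rule finite_imageI)
  then show ?thesis
    using type_definition.Abs_image[OF type_definition_zvar] by simp
qed

lemma mono_degree_UNIV: "mono_degree m = (\<Sum>v\<in>UNIV. Poly_Mapping.lookup m v)"
  unfolding mono_degree_def by (rule sum.mono_neutral_left) (auto simp: in_keys_iff)

lemma mono_degree_add: "mono_degree (m + n) = mono_degree m + mono_degree n"
  by (simp add: mono_degree_UNIV lookup_add sum.distrib)

lemma mono_degree_single [simp]: "mono_degree (Poly_Mapping.single v n) = n"
  by (simp add: mono_degree_def)

lemma mono_degree_0 [simp]: "mono_degree 0 = 0"
  by (simp add: mono_degree_def)

lemma mono_degree_eq_0: "mono_degree m = 0 \<longleftrightarrow> m = 0"
proof
  assume "mono_degree m = 0"
  then show "m = 0"
    by (intro poly_mapping_eqI) (simp add: mono_degree_UNIV)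
qed simp

definition homogeneous :: "nat \<Rightarrow> 'k::comm_ring_1 zpoly \<Rightarrow> bool" where
  "homogeneous n f \<longleftrightarrow> (\<forall>m\<in>Poly_Mapping.keys f. mono_degree m = n)"

lemma homogeneous_0 [simp]: "homogeneous n 0"
  by (simp add: homogeneous_def)

lemma homogeneous_const [simp]: "homogeneous 0 (const c)"
  by (simp add: homogeneous_def)

lemma homogeneous_single: "mono_degree m = n \<Longrightarrow> homogeneous n (Poly_Mapping.single m c)"
  by (simp add: homogeneous_def)

lemma homogeneous_lookup: "homogeneous n f \<Longrightarrow> mono_degree m \<noteq> n \<Longrightarrow> Poly_Mapping.lookup f m = 0"
  by (auto simp: homogeneous_def in_keys_iff)

lemma homogeneous_add: "homogeneous n f \<Longrightarrow> homogeneous n g \<Longrightarrow> homogeneous n (f + g)"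
  using keys_add[of f g] by (auto simp: homogeneous_def)

lemma homogeneous_mult: "homogeneous n f \<Longrightarrow> homogeneous k g \<Longrightarrow> homogeneous (n + k) (f * g)"
  using keys_mult[of f g] by (fastforce simp: homogeneous_def mono_degree_add)

lemma homogeneous_sum: "(\<And>i. i \<in> A \<Longrightarrow> homogeneous n (f i)) \<Longrightarrow> homogeneous n (sum f A)"
  by (induction A rule: infinite_finite_induct) (simp_all add: homogeneous_add)

lemma homogeneous_power: "homogeneous n f \<Longrightarrow> homogeneous (q * n) (f ^ q)"
  by (induction q) (simp_all add: homogeneous_mult single_one[symmetric] del: single_one)

lemma lookup_mult_eq_0:
  assumes "homogeneous n f" "mono_degree m = n" "Poly_Mapping.lookup g 0 = 0"
  shows "Poly_Mapping.lookup (f * g) m = 0"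
proof (rule ccontr)
  assume "Poly_Mapping.lookup (f * g) m \<noteq> 0"
  then have "m \<in> Poly_Mapping.keys (f * g)"
    by (simp add: in_keys_iff)
  then obtain a b where ab: "m = a + b" "a \<in> Poly_Mapping.keys f" "b \<in> Poly_Mapping.keys g"
    using keys_mult[of f g] by blast
  then have "mono_degree b = 0"
    using assms(1,2) by (simp add: homogeneous_def mono_degree_add)
  then show False
    using ab(3) assms(3) by (simp add: mono_degree_eq_0 in_keys_iff)
qed

lemma lookup_mult_const: "Poly_Mapping.lookup (f * const c) m = Poly_Mapping.lookup f m * c"
proof -
  define g where "g = f - Poly_Mapping.single m (Poly_Mapping.lookup f m)"
  have "m \<notin> Poly_Mapping.keys (g * const c)"
  proof
    assume "m \<in> Poly_Mapping.keys (g * const c)"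
    then have "m \<in> Poly_Mapping.keys g"
      using keys_mult[of g "const c"] by (auto split: if_splits)
    then show False
      by (simp add: g_def in_keys_iff lookup_minus)
  qed
  moreover have "f * const c = g * const c + Poly_Mapping.single m (Poly_Mapping.lookup f m * c)"
    by (simp add: g_def algebra_simps mult_single)
  ultimately show ?thesis
    by (simp add: lookup_add in_keys_iff)
qed

text \<open>The source of constant matrices: in the lowest possible degree, a product with a homogeneous
polynomial only sees the constant term of the other factor.\<close>

lemma lookup_mult_homogeneous:
  assumes "homogeneous n f" "mono_degree m = n"
  shows "Poly_Mapping.lookup (f * g) m = Poly_Mapping.lookup f m * Poly_Mapping.lookup g 0"
proof -
  define h where "h = g - const (Poly_Mapping.lookup g 0)"
  have "f * g = f * h + f * const (Poly_Mapping.lookup g 0)"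
    by (simp add: h_def algebra_simps)
  moreover have "Poly_Mapping.lookup (f * h) m = 0"
    using assms by (rule lookup_mult_eq_0) (simp add: h_def lookup_minus)
  ultimately show ?thesis
    by (simp add: lookup_add lookup_mult_const)
qed

section \<open>The generic skew matrix\<close>

text \<open>The relabelled generic matrix. The results about the polynomial ring are stated for it, so that the triples (a,b,c)
other than (3,4,5) need no computation of their own.\<close>

definition zperm :: "(nat \<Rightarrow> nat) \<Rightarrow> nat \<Rightarrow> nat \<Rightarrow> 'k::comm_ring_1 zpoly" where
  "zperm \<sigma> i j = z (\<sigma> i) (\<sigma> j)"

lemma skew_zperm [simp]: "skew (zperm \<sigma>)"
  by (auto simp: skew_def zperm_def z_def)

lemma zX_power: "zX v ^ n = Poly_Mapping.single (Poly_Mapping.single v n) 1"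
  by (induction n) (simp_all add: zX_def mult_single flip: single_add)

text \<open>The variable that occurs, up to sign, in the entry at an edge of the relabelled matrix.\<close>

definition edge_var :: "(nat \<Rightarrow> nat) \<Rightarrow> nat \<times> nat \<Rightarrow> zvar" where
  "edge_var \<sigma> e = Abs_zvar (min (\<sigma> (fst e)) (\<sigma> (snd e)), max (\<sigma> (fst e)) (\<sigma> (snd e)))"

definition monomial_of :: "(nat \<Rightarrow> nat) \<Rightarrow> nat list \<Rightarrow> zvar \<Rightarrow>\<^sub>0 nat" where
  "monomial_of \<sigma> e = sum_list (map2 (\<lambda>p n. Poly_Mapping.single (edge_var \<sigma> p) n) edges e)"

lemma zperm_power:
  assumes "\<sigma> i \<noteq> \<sigma> j"
  shows "\<exists>s::int. (s = 1 \<or> s = -1) \<and>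
    zperm \<sigma> i j ^ n = Poly_Mapping.single (Poly_Mapping.single (edge_var \<sigma> (i, j)) n) (of_int s)"
proof (cases "\<sigma> i < \<sigma> j")
  case True
  then show ?thesis
    by (intro exI[of _ 1]) (simp add: zperm_def z_def zX_power edge_var_def)
next
  case False
  then have "zperm \<sigma> i j = - zX (edge_var \<sigma> (i, j))"
    using assms by (simp add: zperm_def z_def edge_var_def)
  then have "zperm \<sigma> i j ^ n = (-1) ^ n * Poly_Mapping.single (Poly_Mapping.single (edge_var \<sigma> (i, j)) n) 1"
    by (metis power_minus zX_power)
  then show ?thesis
    by (intro exI[of _ "(-1) ^ n"]) (cases "even n"; simp add: single_uminus)
qed

lemma zperm_monomial:
  assumes "\<And>i j. (i, j) \<in> set ps \<Longrightarrow> \<sigma> i \<noteq> \<sigma> j"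
  shows "\<exists>s::int. (s = 1 \<or> s = -1) \<and> prod_list (map2 (\<lambda>(i,j) n. zperm \<sigma> i j ^ n) ps e) =
    Poly_Mapping.single (sum_list (map2 (\<lambda>p n. Poly_Mapping.single (edge_var \<sigma> p) n) ps e)) (of_int s)"
  using assms
proof (induction ps arbitrary: e)
  case Nil
  show ?case by (intro exI[of _ 1]) simp
next
  case (Cons p ps)
  obtain i j where p: "p = (i, j)" by (cases p)
  show ?case
  proof (cases e)
    case Nil
    then show ?thesis by (intro exI[of _ 1]) simp
  next
    case e: (Cons n e')
    have ne: "\<sigma> i \<noteq> \<sigma> j" and "\<And>i j. (i, j) \<in> set ps \<Longrightarrow> \<sigma> i \<noteq> \<sigma> j"
      using Cons.prems by (auto simp: p)
    then obtain s :: int where "s = 1 \<or> s = -1"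
      "prod_list (map2 (\<lambda>(i,j) n. zperm \<sigma> i j ^ n) ps e') = Poly_Mapping.single
        (sum_list (map2 (\<lambda>p n. Poly_Mapping.single (edge_var \<sigma> p) n) ps e')) (of_int s :: 'a)"
      using Cons.IH[of e'] by blast
    moreover obtain t :: int where "t = 1 \<or> t = -1"
      "zperm \<sigma> i j ^ n = Poly_Mapping.single (Poly_Mapping.single (edge_var \<sigma> (i, j)) n) (of_int t :: 'a)"
      using zperm_power[of \<sigma> i j, OF ne] by blast
    ultimately show ?thesis
      by (intro exI[of _ "t * s"]) (auto simp: e p mult_single)
  qed
qed

lemma permutes_edge:
  assumes "\<sigma> permutes {1..5}" "(i, j) \<in> set edges"
  shows "\<sigma> i \<noteq> \<sigma> j"
  using assms(2) permutes_inj[OF assms(1)] by (auto simp: edges_def inj_eq)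

text \<open>Relabelling changes the sign of some variables; the total sign depends on the exponents only, not
on the coefficient.\<close>

lemma sm_value_zperm:
  assumes "\<sigma> permutes {1..5}"
  shows "\<exists>s::int. (s = 1 \<or> s = -1) \<and>
    (\<forall>c. sm_value (zperm \<sigma>) (c, e) =
      (Poly_Mapping.single (monomial_of \<sigma> e) (of_int (s * c)) :: 'k::comm_ring_1 zpoly))"
proof -
  obtain s :: int where s: "s = 1 \<or> s = -1"
    and eq: "prod_list (map2 (\<lambda>(i,j) n. zperm \<sigma> i j ^ n) edges e) =
      (Poly_Mapping.single (monomial_of \<sigma> e) (of_int s) :: 'k zpoly)"
    using zperm_monomial[of edges \<sigma> e] permutes_edge[OF assms] unfolding monomial_of_def by blast
  have scale: "of_int c * Poly_Mapping.single m d = Poly_Mapping.single m (of_int c * d)" for c m and d :: 'k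
    by (simp add: mult_single flip: single_of_int)
  have "sm_value (zperm \<sigma>) (c, e) =
      (Poly_Mapping.single (monomial_of \<sigma> e) (of_int (s * c)) :: 'k zpoly)" for c
    unfolding sm_value_def fst_conv snd_conv eq scale by (simp add: mult.commute)
  then show ?thesis using s by blast
qed

lemma edgeD: "(i, j) \<in> set edges \<Longrightarrow> i < j \<and> 1 \<le> i \<and> j \<le> 5"
  by (auto simp: edges_def)

lemma inj_on_edge_var:
  assumes "\<sigma> permutes {1..5}"
  shows "inj_on (edge_var \<sigma>) (set edges)"
proof (rule inj_onI)
  fix p q assume pq: "p \<in> set edges" "q \<in> set edges" "edge_var \<sigma> p = edge_var \<sigma> q"
  obtain i j k l where [simp]: "p = (i, j)" "q = (k, l)" by (cases p, cases q)
  have ij: "i < j" "k < l" "{i, j, k, l} \<subseteq> {1..5}"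
    using edgeD[of i j] edgeD[of k l] pq(1,2) by simp_all
  have mem: "(min (\<sigma> i) (\<sigma> j), max (\<sigma> i) (\<sigma> j)) \<in> {(i, j). 1 \<le> i \<and> i < j \<and> j \<le> 5}"
    if "i < j" "{i, j} \<subseteq> {1..5}" for i j
  proof -
    have "\<sigma> i \<in> {1..5}" "\<sigma> j \<in> {1..5}" "\<sigma> i \<noteq> \<sigma> j"
      using that permutes_in_image[OF assms] permutes_inj[OF assms] by (auto simp: inj_eq)
    then show ?thesis by auto
  qed
  have "(min (\<sigma> i) (\<sigma> j), max (\<sigma> i) (\<sigma> j)) = (min (\<sigma> k) (\<sigma> l), max (\<sigma> k) (\<sigma> l))"
    using pq(3) mem[of i j] mem[of k l] ij by (simp add: edge_var_def Abs_zvar_inject)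
  then have "\<sigma> i = \<sigma> k \<and> \<sigma> j = \<sigma> l \<or> \<sigma> i = \<sigma> l \<and> \<sigma> j = \<sigma> k"
    by (auto simp: min_def max_def split: if_splits)
  then show "p = q"
    using ij permutes_inj[OF assms] by (auto simp: inj_eq)
qed

lemma lookup_sum_list_notin:
  assumes "v \<notin> set vs"
  shows "Poly_Mapping.lookup (sum_list (map2 Poly_Mapping.single vs e)) v = (0::nat)"
  using assms
proof (induction vs arbitrary: e)
  case (Cons w vs)
  then show ?case by (cases e) (auto simp: lookup_add lookup_single)
qed simp

lemma sum_list_single_inject:
  assumes "length vs = length e" "length e = length e'" "distinct vs"
    and "sum_list (map2 Poly_Mapping.single vs e) = sum_list (map2 Poly_Mapping.single vs (e' :: nat list))"
  shows "e = e'"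
  using assms
proof (induction vs e e' rule: list_induct3)
  case (Cons v vs n e n' e')
  have "Poly_Mapping.lookup (sum_list (map2 Poly_Mapping.single (v # vs) (n # e))) v = n"
    "Poly_Mapping.lookup (sum_list (map2 Poly_Mapping.single (v # vs) (n' # e'))) v = n'"
    using Cons.prems(1) by (simp_all add: lookup_add lookup_sum_list_notin)
  then have "n = n'"
    using Cons.prems(2) by simp
  then show ?case
    using Cons by simp
qed simp

lemma monomial_of_inject:
  assumes "\<sigma> permutes {1..5}" "length e = 10" "length e' = 10"
    and "monomial_of \<sigma> e = monomial_of \<sigma> e'"
  shows "e = e'"
proof -
  have eq: "map2 (\<lambda>p n. Poly_Mapping.single (edge_var \<sigma> p) n) ps f =
      map2 Poly_Mapping.single (map (edge_var \<sigma>) ps) f" for ps and f :: "nat list"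
    by (simp add: zip_map1 case_prod_unfold)
  have "distinct edges" by (simp add: edges_def)
  then have "distinct (map (edge_var \<sigma>) edges)"
    using inj_on_edge_var[OF assms(1)] by (simp add: distinct_map)
  then show ?thesis
    using assms(2-4) sum_list_single_inject[of "map (edge_var \<sigma>) edges" e e']
    by (simp add: monomial_of_def eq)
qed

lemma mono_degree_sum_list:
  "length ps = length e \<Longrightarrow>
    mono_degree (sum_list (map2 (\<lambda>p n. Poly_Mapping.single (f p) n) ps e)) = sum_list e"
  by (induction ps e rule: list_induct2) (simp_all add: mono_degree_add)

lemma homogeneous_value_of:
  assumes "\<sigma> permutes {1..5}" "homog_poly n p"
  shows "homogeneous n (value_of (zperm \<sigma>) p)"
  using assms(2)
proof (induction p)
  case (Cons t p)
  obtain c e where t: "t = (c, e)" by (cases t)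
  obtain s :: int where "sm_value (zperm \<sigma>) t =
      (Poly_Mapping.single (monomial_of \<sigma> e) (of_int (s * c)) :: 'a zpoly)"
    using sm_value_zperm[OF assms(1)] t by blast
  moreover have "mono_degree (monomial_of \<sigma> e) = n"
    using Cons.prems mono_degree_sum_list[of edges e "edge_var \<sigma>"]
    by (simp add: t homog_poly_def monomial_of_def)
  ultimately show ?case
    using Cons by (simp add: homogeneous_add homogeneous_single homog_poly_def)
qed simp

lemma homog_poly_wf: "homog_poly n p \<Longrightarrow> wf_poly p"
  by (simp add: homog_poly_def wf_poly_def list_all_iff)

text \<open>Different exponent lists are different monomials of the polynomial ring, so there is no cancellation between
them.\<close>

lemma lookup_value_of:
  assumes \<sigma>: "\<sigma> permutes {1..5}" and e: "length e = 10"
  obtains s :: int where "s = 1 \<or> s = -1"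
    and "\<And>p. wf_poly p \<Longrightarrow> Poly_Mapping.lookup (value_of (zperm \<sigma>) p) (monomial_of \<sigma> e) =
      (of_int (s * poly_coeff p e) :: 'k::comm_ring_1)"
proof -
  obtain s :: int where s: "s = 1 \<or> s = -1"
    and eq: "\<And>c. sm_value (zperm \<sigma>) (c, e) =
      (Poly_Mapping.single (monomial_of \<sigma> e) (of_int (s * c)) :: 'k zpoly)"
    using sm_value_zperm[OF \<sigma>, of e] by blast
  have "Poly_Mapping.lookup (value_of (zperm \<sigma>) p) (monomial_of \<sigma> e) =
      (of_int (s * poly_coeff p e) :: 'k)" if "wf_poly p" for p
    using that
  proof (induction p)
    case (Cons t p)
    obtain c f where t: "t = (c, f)" by (cases t)
    obtain s' :: int where eq': "sm_value (zperm \<sigma>) t =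
        (Poly_Mapping.single (monomial_of \<sigma> f) (of_int (s' * c)) :: 'k zpoly)"
      using sm_value_zperm[OF \<sigma>] t by blast
    show ?case
    proof (cases "f = e")
      case True
      then show ?thesis
        using Cons by (simp add: t eq poly_coeff_def lookup_add distrib_left del: of_int_mult)
    next
      case False
      then have "monomial_of \<sigma> f \<noteq> monomial_of \<sigma> e"
        using monomial_of_inject[OF \<sigma>] e Cons.prems t by auto
      then show ?thesis
        using Cons False by (simp add: eq' poly_coeff_def lookup_add lookup_single_not_eq)
          (simp add: t)
    qed
  qed (simp add: poly_coeff_def)
  then show thesis using that s by blast
qed

text \<open>A monomial that occurs in exactly one of several polynomials, with coefficient 1 or -1, isolates the scalar of
that polynomial in a linear relation.\<close>

lemma independent_by_coeff:
  fixes c :: "'a \<Rightarrow> 'k::comm_ring_1"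
  assumes \<sigma>: "\<sigma> permutes {1..5}" and e: "length e = 10"
    and J: "finite J" "i \<in> J" "\<And>j. j \<in> J \<Longrightarrow> wf_poly (p j)"
    and coeff: "\<And>j. j \<in> J \<Longrightarrow> poly_coeff (p j) e = (if i = j then u else 0)" "u = 1 \<or> u = -1"
    and eq: "(\<Sum>j\<in>J. value_of (zperm \<sigma>) (p j) * const (c j)) = 0"
  shows "c i = 0"
proof -
  obtain s :: int where s: "s = 1 \<or> s = -1"
    and lk: "\<And>p. wf_poly p \<Longrightarrow> Poly_Mapping.lookup (value_of (zperm \<sigma>) p) (monomial_of \<sigma> e) =
      (of_int (s * poly_coeff p e) :: 'k)"
    using lookup_value_of[OF \<sigma> e] by blast
  have "0 = Poly_Mapping.lookup (\<Sum>j\<in>J. value_of (zperm \<sigma>) (p j) * const (c j)) (monomial_of \<sigma> e)"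
    by (simp add: eq)
  also have "\<dots> = (\<Sum>j\<in>J. if i = j then of_int (s * u) * c j else 0)"
    unfolding lookup_sum
    by (rule sum.cong) (simp_all add: lookup_mult_const lk J coeff)
  also have "\<dots> = of_int (s * u) * c i"
    using J by simp
  finally show ?thesis
    using s coeff(2) by auto
qed

section \<open>The action of permutations on monomials\<close>

definition zvar_image :: "(nat \<Rightarrow> nat) \<Rightarrow> zvar \<Rightarrow> 'k::comm_ring_1 zpoly" where
  "zvar_image \<tau> v = (case Rep_zvar v of (i, j) \<Rightarrow> z (\<tau> i) (\<tau> j))"

lemma perm_act_single:
  "perm_act \<tau> (Poly_Mapping.single m c) =
    const c * (\<Prod>v\<in>UNIV. zvar_image \<tau> v ^ Poly_Mapping.lookup m v)"
proof -
  have "(\<Prod>v\<in>Poly_Mapping.keys m. zvar_image \<tau> v ^ Poly_Mapping.lookup m v) =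
      (\<Prod>v\<in>UNIV. zvar_image \<tau> v ^ Poly_Mapping.lookup m v :: 'a zpoly)"
    by (rule prod.mono_neutral_left) (auto simp: in_keys_iff)
  then show ?thesis
    by (simp add: perm_act_def zvar_image_def)
qed

text \<open>The orbits in question are orbits of single terms. On these, the sum over monomials that defines the action of a
permutation collapses, and the action is visibly multiplicative.\<close>

definition is_term :: "'k::comm_ring_1 zpoly \<Rightarrow> bool" where
  "is_term f \<longleftrightarrow> (\<exists>m c. f = Poly_Mapping.single m c)"

lemma is_term_mult: "is_term f \<Longrightarrow> is_term g \<Longrightarrow> is_term (f * g)"
  unfolding is_term_def by (metis mult_single)

lemma is_term_1: "is_term 1"
  unfolding is_term_def by (metis single_one)

lemma is_term_power: "is_term f \<Longrightarrow> is_term (f ^ n)"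
  by (induction n) (simp_all add: is_term_1 is_term_mult)

lemma perm_act_1: "perm_act \<tau> 1 = 1"
  using perm_act_single[of \<tau> 0 1] by simp

lemma perm_act_mult:
  assumes "is_term f" "is_term g"
  shows "perm_act \<tau> (f * g) = perm_act \<tau> f * perm_act \<tau> g"
proof -
  obtain m c n d where f: "f = Poly_Mapping.single m c" and g: "g = Poly_Mapping.single n d"
    using assms by (auto simp: is_term_def)
  have const_mult: "const (c * d) = const c * const d"
    by (simp add: mult_single)
  show ?thesis
    unfolding f g mult_single[of m] perm_act_single const_mult
    by (simp add: lookup_add power_add prod.distrib mult_ac)
qed

lemma perm_act_power: "is_term f \<Longrightarrow> perm_act \<tau> (f ^ n) = perm_act \<tau> f ^ n"
  by (induction n) (simp_all add: perm_act_1 perm_act_mult is_term_power)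

lemma is_term_z: "is_term (z i j)"
  unfolding is_term_def z_def zX_def by (metis single_uminus single_zero)

lemma perm_act_z:
  assumes "i \<noteq> j" "i \<in> {1..5}" "j \<in> {1..5}"
  shows "perm_act \<tau> (z i j) = zperm \<tau> i j"
proof -
  have sgl: "(\<Prod>w\<in>UNIV. zvar_image \<tau> w ^ Poly_Mapping.lookup (Poly_Mapping.single v 1) w) =
      (zvar_image \<tau> v :: 'a zpoly)" for v
  proof -
    have "(\<Prod>w\<in>UNIV. zvar_image \<tau> w ^ Poly_Mapping.lookup (Poly_Mapping.single v 1) w) =
        (\<Prod>w\<in>UNIV. if v = w then zvar_image \<tau> w else (1 :: 'a zpoly))"
      by (rule prod.cong) (auto simp: lookup_single)
    then show ?thesis by simp
  qed
  have img: "zvar_image \<tau> (Abs_zvar (i, j)) = (z (\<tau> i) (\<tau> j) :: 'a zpoly)"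
    if "i < j" "1 \<le> i" "j \<le> 5" for i j
    using that by (simp add: zvar_image_def Abs_zvar_inverse)
  show ?thesis
  proof (cases "i < j")
    case True
    then show ?thesis
      using assms img[of i j] sgl by (simp add: z_def[of i] zX_def perm_act_single zperm_def)
  next
    case False
    then have eq: "z i j = Poly_Mapping.single (Poly_Mapping.single (Abs_zvar (j, i)) 1) (-1 :: 'a)"
      using assms by (simp add: z_def zX_def single_uminus)
    have "perm_act \<tau> (z i j) = const (-1) * (z (\<tau> j) (\<tau> i) :: 'a zpoly)"
      unfolding eq perm_act_single sgl using False assms img[of j i] by simp
    then have "perm_act \<tau> (z i j) = - (z (\<tau> j) (\<tau> i) :: 'a zpoly)"
      by (simp add: single_uminus)
    also have "\<dots> = zperm \<tau> i j"
      by (auto simp: zperm_def z_def)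
    finally show ?thesis .
  qed
qed

lemma perm_act_edge_value:
  assumes "is_edge_list l"
  shows "is_term (edge_value z l :: 'k::comm_ring_1 zpoly) \<and>
    perm_act \<tau> (edge_value z l) = (edge_value (zperm \<tau>) l :: 'k zpoly)"
  using assms
proof (induction l rule: sm_of.induct)
  case (2 i j n l)
  then have IH: "is_term (edge_value z l :: 'k zpoly)"
      "perm_act \<tau> (edge_value z l) = (edge_value (zperm \<tau>) l :: 'k zpoly)"
    and ij: "i \<noteq> j" "i \<in> {1..5}" "j \<in> {1..5}"
    by (simp_all add: is_edge_list_def)
  have split: "edge_value x ((i, j, n) # l) = x i j ^ n * edge_value x l" for x :: "nat \<Rightarrow> nat \<Rightarrow> 'k zpoly"
    by (simp add: edge_value_def)
  show ?case
    unfolding split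
    by (simp add: IH is_term_mult is_term_power is_term_z perm_act_mult perm_act_power
        perm_act_z[OF ij])
qed (simp add: edge_value_def is_term_1 perm_act_1)

lemma is_edge_list_relabel:
  assumes "\<sigma> permutes {1..5}" "is_edge_list l"
  shows "is_edge_list (relabel \<sigma> l)"
  using assms(2)
proof (induction l rule: sm_of.induct)
  case (2 i j n l)
  then have ij: "i \<noteq> j" "i \<in> {1..5}" "j \<in> {1..5}" and "is_edge_list (relabel \<sigma> l)"
    by (simp_all add: is_edge_list_def)
  moreover have "\<sigma> i \<noteq> \<sigma> j" "\<sigma> i \<in> {1..5}" "\<sigma> j \<in> {1..5}"
    using ij permutes_in_image[OF assms(1)] permutes_inj[OF assms(1)] by (simp_all only: inj_eq not_False_eq_True)
  ultimately show ?case
    by (simp add: is_edge_list_def)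
qed simp

lemma perm_act_zperm:
  assumes "\<sigma> permutes {1..5}" "is_edge_list l"
  shows "perm_act \<tau> (edge_value (zperm \<sigma>) l) =
    (edge_value (zperm (\<tau> \<circ> \<sigma>)) l :: 'k::comm_ring_1 zpoly)"
proof -
  have *: "edge_value (zperm f) (relabel \<sigma> l) = (edge_value (zperm (f \<circ> \<sigma>)) l :: 'k zpoly)" for f
    unfolding edge_value_relabel by (simp add: zperm_def[abs_def])
  have id: "zperm id = (z :: nat \<Rightarrow> nat \<Rightarrow> 'k zpoly)"
    by (simp add: zperm_def[abs_def])
  show ?thesis
    using perm_act_edge_value[where 'k = 'k and \<tau> = \<tau>, OF is_edge_list_relabel[OF assms]] *[of id] *[of \<tau>]
    by (simp add: id)
qed

section \<open>Orbit sums\<close>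

lemma perms5_iff: "l \<in> set perms5 \<longleftrightarrow> length l = 5 \<and> distinct l \<and> set l \<subseteq> {1..5}"
proof
  assume l: "length l = 5 \<and> distinct l \<and> set l \<subseteq> {1..5}"
  then obtain a b c d e where "l = [a, b, c, d, e]"
    by (auto simp: length_Suc_conv eval_nat_numeral)
  then show "l \<in> set perms5"
    using l by (auto simp: perms5_def)
qed (auto simp: perms5_def)

lemma as_fun_permutes:
  assumes "l \<in> set perms5"
  shows "as_fun l permutes {1..5}"
proof (rule bij_imp_permutes)
  have l: "length l = 5" "distinct l" "set l \<subseteq> {1..5}"
    using assms by (auto simp: perms5_iff)
  have "set l = {1..5}"
    by (rule card_subset_eq) (use l distinct_card[of l] in auto)
  then have "bij_betw ((!) l) {..<5} {1..5}"
    using l by (intro bij_betw_nth) auto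
  moreover have "bij_betw (\<lambda>i. i - 1) {1..5::nat} {..<5}"
    by (rule bij_betw_byWitness[where f' = Suc]) auto
  ultimately have "bij_betw ((!) l \<circ> (\<lambda>i. i - 1)) {1..5} {1..5}"
    by (rule bij_betw_trans[rotated])
  then show "bij_betw (as_fun l) {1..5} {1..5}"
    by (rule bij_betw_cong[THEN iffD1, rotated]) (simp add: as_fun_def l)
  show "as_fun l i = i" if "i \<notin> {1..5}" for i
    using that l by (auto simp: as_fun_def)
qed

lemma permutes_as_fun:
  assumes "p permutes {1..5}"
  shows "\<exists>l\<in>set perms5. as_fun l = p"
proof
  have "p i = as_fun (map p [1..<6]) i" for i
    using permutes_not_in[OF assms, of i] by (auto simp: as_fun_def nth_append)
  then show "as_fun (map p [1..<6]) = p"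
    by auto
  show "map p [1..<6] \<in> set perms5"
    using permutes_in_image[OF assms] permutes_inj_on[OF assms] by (auto simp: perms5_iff distinct_map)
qed

lemma as_fun_comp:
  assumes "length l = 5" "length m = 5"
  shows "as_fun (map (as_fun l) m) = as_fun l \<circ> as_fun m"
  using assms by (auto simp: as_fun_def fun_eq_iff)

text \<open>An orbit is a set of polynomials, while \<open>orbit_list\<close> removes duplicates among normal forms. The two sums agree
because evaluation is injective on normal forms with coefficient 1 or -1, provided that 1 and -1 are different.\<close>

lemma orbit_sum_eq:
  fixes p :: "'k::field zpoly"
  assumes char: "(1::'k) \<noteq> -1" and \<sigma>: "\<sigma> permutes {1..5}" and l: "is_edge_list l"
    and L: "set L \<subseteq> set perms5"
    and G: "(\<lambda>\<gamma>. perm_act \<gamma> p) ` G = (\<lambda>m. edge_value (zperm (\<sigma> \<circ> as_fun m)) l) ` set L"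
  shows "orbit_sum G p = value_of (zperm \<sigma>) (orbit_list L l)"
proof -
  have "edge_value (zperm (\<sigma> \<circ> as_fun m)) l = (sm_value (zperm \<sigma>) (orbit_sm l m) :: 'k zpoly)"
    if "m \<in> set L" for m
  proof -
    have "is_edge_list (relabel (as_fun m) l)"
      using that L l by (intro is_edge_list_relabel as_fun_permutes) auto
    then have "sm_value (zperm \<sigma>) (orbit_sm l m) = (edge_value (zperm \<sigma>) (relabel (as_fun m) l) :: 'k zpoly)"
      by (simp add: orbit_sm_def sm_value_sm_of)
    then show ?thesis
      unfolding edge_value_relabel by (simp add: zperm_def[abs_def])
  qed
  then have img: "(\<lambda>\<gamma>. perm_act \<gamma> p) ` G = sm_value (zperm \<sigma>) ` set (orbit_list L l)"
    unfolding G by (simp add: orbit_list_def image_image)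
  have "inj_on (sm_value (zperm \<sigma>) :: _ \<Rightarrow> 'k zpoly) (set (orbit_list L l))"
  proof (rule inj_onI)
    fix t t' assume t: "t \<in> set (orbit_list L l)" "t' \<in> set (orbit_list L l)"
      and eq: "sm_value (zperm \<sigma>) t = (sm_value (zperm \<sigma>) t' :: 'k zpoly)"
    obtain c e c' e' where [simp]: "t = (c, e)" "t' = (c', e')" by (cases t, cases t')
    have len: "length e = 10" "length e' = 10" and sgn: "c = 1 \<or> c = -1" "c' = 1 \<or> c' = -1"
      using t sm_of_sign unfolding orbit_list_def orbit_sm_def
      by (auto simp: prod_eq_iff) metis+
    obtain s s' :: int where s: "s = 1 \<or> s = -1" "s' = 1 \<or> s' = -1"
      and v: "\<And>c. sm_value (zperm \<sigma>) (c, e) = (Poly_Mapping.single (monomial_of \<sigma> e) (of_int (s * c)) :: 'k zpoly)"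
      "\<And>c. sm_value (zperm \<sigma>) (c, e') = (Poly_Mapping.single (monomial_of \<sigma> e') (of_int (s' * c)) :: 'k zpoly)"
      using sm_value_zperm[OF \<sigma>, where 'k = 'k] by metis
    have ne: "(of_int (s * c) :: 'k) \<noteq> 0"
      using s(1) sgn(1) by auto
    have "Poly_Mapping.keys (Poly_Mapping.single (monomial_of \<sigma> e) (of_int (s * c) :: 'k)) =
        Poly_Mapping.keys (Poly_Mapping.single (monomial_of \<sigma> e') (of_int (s' * c') :: 'k))"
      using eq by (simp add: v)
    then have "monomial_of \<sigma> e = monomial_of \<sigma> e'"
      using ne by (auto split: if_splits)
    then have e: "e = e'"
      using monomial_of_inject[OF \<sigma>] len by blast
    have "Poly_Mapping.lookup (sm_value (zperm \<sigma>) t) (monomial_of \<sigma> e) =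
        Poly_Mapping.lookup (sm_value (zperm \<sigma>) t' :: 'k zpoly) (monomial_of \<sigma> e)"
      using eq by simp
    then have "(of_int (s * c) :: 'k) = of_int (s * c')"
      using e v(1)[of c] v(1)[of c'] by simp
    then have "(of_int c :: 'k) = of_int c'"
      using s(1) by auto
    then have "c = c'"
      using sgn char char[symmetric] by auto
    then show "t = t'"
      using e by simp
  qed
  then show ?thesis
    by (simp add: orbit_sum_def img sum.reindex value_of_def)
      (simp add: sum_list_distinct_conv_sum_set orbit_list_def)
qed

text \<open>The orbit under the full group may be started at any relabelling \<open>\<sigma>\<close>.\<close>

lemma Q_value:
  assumes char: "(1::'k::field) \<noteq> -1" and \<sigma>: "\<sigma> permutes {1..5}" and l: "is_edge_list l"
  shows "Q (edge_value z l :: 'k zpoly) = value_of (zperm \<sigma>) (orbit_list perms5 l)"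
  unfolding Q_def
proof (rule orbit_sum_eq[OF char \<sigma> l])
  have "(\<lambda>\<gamma>. perm_act \<gamma> (edge_value z l)) ` carrier (sym_group 5) =
      (\<lambda>\<gamma>. edge_value (zperm \<gamma>) l :: 'k zpoly) ` {\<gamma>. \<gamma> permutes {1..5}}"
    using perm_act_edge_value[where 'k = 'k, OF l] by (simp add: sym_group_def)
  also have "{\<gamma>. \<gamma> permutes {1..5}} = (\<lambda>m. \<sigma> \<circ> as_fun m) ` set perms5"
  proof (intro equalityI subsetI)
    fix \<gamma> assume "\<gamma> \<in> {\<gamma>. \<gamma> permutes {1..5::nat}}"
    then have "inv_into UNIV \<sigma> \<circ> \<gamma> permutes {1..5}"
      by (intro permutes_compose permutes_inv \<sigma>) auto
    then obtain m where "m \<in> set perms5" "as_fun m = inv_into UNIV \<sigma> \<circ> \<gamma>"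
      using permutes_as_fun by blast
    moreover have "\<sigma> \<circ> (inv_into UNIV \<sigma> \<circ> \<gamma>) = \<gamma>"
      using permutes_inv_o(1)[OF \<sigma>] by (simp flip: o_assoc add: o_assoc)
    ultimately show "\<gamma> \<in> (\<lambda>m. \<sigma> \<circ> as_fun m) ` set perms5"
      by (metis image_eqI)
  qed (use permutes_compose[OF as_fun_permutes \<sigma>] in blast)
  finally show "(\<lambda>\<gamma>. perm_act \<gamma> (edge_value z l)) ` carrier (sym_group 5) =
      (\<lambda>m. edge_value (zperm (\<sigma> \<circ> as_fun m)) l :: 'k zpoly) ` set perms5"
    by (simp add: image_image)
qed simp

lemma funpow_as_fun:
  assumes "length l = 5" "length m = 5"
  shows "length ((map (as_fun l) ^^ k) m) = 5 \<and>
    as_fun ((map (as_fun l) ^^ k) m) = (as_fun l ^^ k) \<circ> as_fun m"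
  by (induction k) (simp_all add: assms as_fun_comp o_assoc)

lemma funpow_generate:
  assumes "f \<in> K"
  shows "f ^^ k \<in> generate (sym_group n) K"
proof (induction k)
  case 0
  show ?case
    using generate.one[of "sym_group n" K] by (simp add: sym_group_one id_def)
next
  case (Suc k)
  then show ?case
    using generate.eng[OF generate.incl[OF assms] Suc] by (simp add: sym_group_mult comp_def)
qed

lemma cycle_as_fun:
  "cycle_of_list [1, 2, 3, 4, 5] = as_fun [2, 3, 4, 5, 1]"
  "cycle_of_list [2, 3, 5, 4] = as_fun [1, 3, 5, 2, 4]"
proof -
  have *: "i = 0 \<or> i = 1 \<or> i = 2 \<or> i = 3 \<or> i = 4 \<or> i = 5 \<or> i > 5" for i :: nat
    by arith
  show "cycle_of_list [1, 2, 3, 4, 5] = as_fun [2, 3, 4, 5, 1]"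
    using * by (fastforce simp: fun_eq_iff as_fun_def Transposition.transpose_def)
  show "cycle_of_list [2, 3, 5, 4] = as_fun [1, 3, 5, 2, 4]"
    using * by (fastforce simp: fun_eq_iff as_fun_def Transposition.transpose_def)
qed

lemma generate_affine5:
  "generate (sym_group 5) {cycle_of_list [1, 2, 3, 4, 5], cycle_of_list [2, 3, 5, 4]} =
    as_fun ` set affine5" (is "generate ?G ?K = _")
proof
  interpret group "sym_group 5" by (rule sym_group_is_group)
  have len: "length l = 5" if "l \<in> set affine5" for l
    using that affine5_perms by (auto simp: list_all_iff perms5_iff)
  have closed: "map (as_fun l) m \<in> set affine5" if "l \<in> set affine5" "m \<in> set affine5" for l m
    using that affine5_closed_checked by (auto simp: list_all_iff affine5_closed_at_def)
  have inverse: "\<exists>m\<in>set affine5. [1, 2, 3, 4, 5] = map (as_fun l) m" if "l \<in> set affine5" for l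
    using that affine5_closed_checked
    unfolding list_all_iff affine5_closed_at_def set_map image_iff by blast
  have one: "as_fun [1, 2, 3, 4, 5] = id"
  proof
    fix i :: nat
    have "i = 0 \<or> i = 1 \<or> i = 2 \<or> i = 3 \<or> i = 4 \<or> i = 5 \<or> i > 5" by arith
    then show "as_fun [1, 2, 3, 4, 5] i = id i" by (auto simp: as_fun_def)
  qed
  have mem: "(map (as_fun [2,3,4,5,1]) ^^ k) ((map (as_fun [1,3,5,2,4]) ^^ j) [1,2,3,4,5]) \<in> set affine5"
    if "k < 5" "j < 4" for k j
    unfolding affine5_def using that by (simp add: image_iff) fastforce
  have perm: "as_fun l permutes {1..5}" if "l \<in> set affine5" for l
    using that affine5_perms by (intro as_fun_permutes) (auto simp: list_all_iff)
  have sub: "subgroup (as_fun ` set affine5) ?G"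
  proof
    show "as_fun ` set affine5 \<subseteq> carrier ?G"
      using perm by (auto simp: sym_group_carrier)
    show "x \<otimes>\<^bsub>?G\<^esub> y \<in> as_fun ` set affine5" if "x \<in> as_fun ` set affine5" "y \<in> as_fun ` set affine5" for x y
      using that closed len by (auto simp: sym_group_mult simp flip: as_fun_comp)
    show "\<one>\<^bsub>?G\<^esub> \<in> as_fun ` set affine5"
      using mem[of 0 0] one by (simp add: sym_group_one image_iff) (metis one)
    show "inv\<^bsub>?G\<^esub> x \<in> as_fun ` set affine5" if x: "x \<in> as_fun ` set affine5" for x
    proof -
      obtain l where l: "l \<in> set affine5" "x = as_fun l" using x by auto
      obtain m where m: "m \<in> set affine5" "[1, 2, 3, 4, 5] = map (as_fun l) m"
        by (rule bexE[OF inverse[OF l(1)]])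
      have "as_fun l \<circ> as_fun m = id"
        using as_fun_comp[of l m] len l m one by simp
      then have "inv\<^bsub>?G\<^esub> x = as_fun m"
        using perm l m
        by (metis inv_equality inv_inv sym_group_carrier sym_group_mult sym_group_one inv_closed)
      then show ?thesis using m by simp
    qed
  qed
  have "?K \<subseteq> as_fun ` set affine5"
    unfolding cycle_as_fun using mem[of 1 0] mem[of 0 1] by (simp add: as_fun_def)
  then show "generate ?G ?K \<subseteq> as_fun ` set affine5"
    using generate_subgroup_incl sub by blast
  show "as_fun ` set affine5 \<subseteq> generate ?G ?K"
  proof
    fix x assume "x \<in> as_fun ` set affine5"
    then obtain k j where
      "x = as_fun ((map (as_fun [2,3,4,5,1]) ^^ k) ((map (as_fun [1,3,5,2,4]) ^^ j) [1,2,3,4,5]))"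
      by (auto simp: affine5_def)
    also have "\<dots> = (as_fun [2,3,4,5,1] ^^ k) \<circ> (as_fun [1,3,5,2,4] ^^ j)"
      by (simp add: funpow_as_fun one[simplified])
    finally have "x = cycle_of_list [1, 2, 3, 4, 5] ^^ k \<circ> cycle_of_list [2, 3, 5, 4] ^^ j"
      by (simp only: cycle_as_fun)
    then show "x \<in> generate ?G ?K"
      using generate.eng[of _ ?G ?K, OF funpow_generate funpow_generate,
          of "cycle_of_list [1, 2, 3, 4, 5]" "cycle_of_list [2, 3, 5, 4]" k j]
      by (simp add: sym_group_mult del: cycle_of_list.simps)
  qed
qed


text \<open>Conjugation by \<open>\<sigma>\<close> is an automorphism that relabels cycles.\<close>

lemma generate_conj:
  assumes \<sigma>: "\<sigma> permutes {1..n}" and C: "\<And>c. c \<in> C \<Longrightarrow> distinct c \<and> set c \<subseteq> {1..n}"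
  shows "generate (sym_group n) ((\<lambda>c. cycle_of_list (map \<sigma> c)) ` C) =
    (\<lambda>\<tau>. \<sigma> \<circ> \<tau> \<circ> inv_into UNIV \<sigma>) ` generate (sym_group n) (cycle_of_list ` C)"
proof -
  have inv: "inv_into UNIV \<sigma> \<circ> \<sigma> = id"
    by (rule permutes_inv_o(2)[OF \<sigma>])
  have "(\<lambda>\<tau>. \<sigma> \<circ> \<tau> \<circ> inv_into UNIV \<sigma>) \<in> hom (sym_group n) (sym_group n)"
  proof (rule homI)
    fix \<tau> \<rho>
    have "\<sigma> \<circ> (\<tau> \<circ> \<rho>) \<circ> inv_into UNIV \<sigma> = \<sigma> \<circ> \<tau> \<circ> (inv_into UNIV \<sigma> \<circ> \<sigma>) \<circ> \<rho> \<circ> inv_into UNIV \<sigma>"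
      unfolding inv by (simp add: o_assoc)
    then show "\<sigma> \<circ> (\<tau> \<otimes>\<^bsub>sym_group n\<^esub> \<rho>) \<circ> inv_into UNIV \<sigma> =
        (\<sigma> \<circ> \<tau> \<circ> inv_into UNIV \<sigma>) \<otimes>\<^bsub>sym_group n\<^esub> (\<sigma> \<circ> \<rho> \<circ> inv_into UNIV \<sigma>)"
      by (simp add: sym_group_mult o_assoc)
  qed (use \<sigma> in \<open>simp add: sym_group_carrier permutes_compose permutes_inv\<close>)
  then interpret group_hom "sym_group n" "sym_group n" "\<lambda>\<tau>. \<sigma> \<circ> \<tau> \<circ> inv_into UNIV \<sigma>"
    by (intro group_hom.intro group_hom_axioms.intro sym_group_is_group)
  have "cycle_of_list ` C \<subseteq> carrier (sym_group n)"
    using C permutes_subset[OF cycle_permutes] unfolding sym_group_def by fastforce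
  moreover have "(\<lambda>\<tau>. \<sigma> \<circ> \<tau> \<circ> inv_into UNIV \<sigma>) ` cycle_of_list ` C = (\<lambda>c. cycle_of_list (map \<sigma> c)) ` C"
    unfolding image_image using C permutes_bij[OF \<sigma>] by (intro image_cong) (simp_all add: conjugation_of_cycle)
  ultimately show ?thesis
    using generate_img[of "cycle_of_list ` C"] by simp
qed

lemma permutation_345:
  assumes "{a, b, c} = {3, 4, 5::nat}"
  shows "[1, 2, a, b, c] \<in> set perms5" "distinct [a, b, c]"
proof -
  have "card {a, b, c} = 3"
    by (simp add: assms)
  then show dist: "distinct [a, b, c]"
    by (auto simp: card_insert_if split: if_splits)
  have "a \<in> {3, 4, 5}" "b \<in> {3, 4, 5}" "c \<in> {3, 4, 5}"
    using assms by auto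
  then show "[1, 2, a, b, c] \<in> set perms5"
    using dist by (auto simp: perms5_iff)
qed

lemma theta_edge_value:
  assumes "{a, b, c} = {3, 4, 5::nat}"
  shows "theta a b c =
    (edge_value (zperm (as_fun [1, 2, a, b, c])) theta_edges :: 'k::comm_ring_1 zpoly)"
proof -
  have "{2..5} = {2, a, b, c}"
    unfolding assms by auto
  moreover have "distinct [2, a, b, c]"
    using permutation_345[OF assms] assms by (auto simp: perms5_iff)
  ultimately have "(\<Prod>i=2..5. z 1 i :: 'k zpoly) = z 1 2 * z 1 a * z 1 b * z 1 c"
    by (simp add: mult_ac)
  then show ?thesis
    by (simp add: theta_def edge_value_def theta_edges_def zperm_def as_fun_def mult_ac)
qed

text \<open>The relabelling \<open>\<sigma>\<close> turns the two generating cycles for (3,4,5) into those for (a,b,c), and \<open>\<theta>\<close> into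
the corresponding monomial. So an element \<open>\<sigma> \<tau> \<sigma>\<^sup>-\<^sup>1\<close> of the group acts on it as \<open>\<tau>\<close> does in the
relabelled matrix.\<close>

lemma U_value:
  assumes char: "(1::'k::field) \<noteq> -1" and abc: "{a, b, c} = {3, 4, 5}"
  shows "(U a b c :: 'k zpoly) = value_of (zperm (as_fun [1, 2, a, b, c])) (orbit_list affine5 theta_edges)"
  unfolding U_def
proof (rule orbit_sum_eq[OF char])
  let ?\<sigma> = "as_fun [1, 2, a, b, c]"
  show \<sigma>: "?\<sigma> permutes {1..5}"
    using permutation_345(1)[OF abc] by (rule as_fun_permutes)
  show edges: "is_edge_list theta_edges"
    by (simp add: is_edge_list_def theta_edges_def)
  show "set affine5 \<subseteq> set perms5"
    using affine5_perms by (auto simp: list_all_iff)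
  have "generate (sym_group 5) {cycle_of_list [1, 2, a, b, c], cycle_of_list [2, a, c, b]} =
      generate (sym_group 5) ((\<lambda>d. cycle_of_list (map ?\<sigma> d)) ` {[1, 2, 3, 4, 5], [2, 3, 5, 4]})"
    by (simp add: as_fun_def del: cycle_of_list.simps)
  also have "\<dots> = (\<lambda>\<tau>. ?\<sigma> \<circ> \<tau> \<circ> inv_into UNIV ?\<sigma>) `
      generate (sym_group 5) (cycle_of_list ` {[1, 2, 3, 4, 5], [2, 3, 5, 4]})"
    using \<sigma> by (intro generate_conj) auto
  also have "\<dots> = (\<lambda>m. ?\<sigma> \<circ> as_fun m \<circ> inv_into UNIV ?\<sigma>) ` set affine5"
    using generate_affine5 by (simp add: image_image del: cycle_of_list.simps)
  finally have gen: "generate (sym_group 5) {cycle_of_list [1, 2, a, b, c], cycle_of_list [2, a, c, b]} =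
      (\<lambda>m. ?\<sigma> \<circ> as_fun m \<circ> inv_into UNIV ?\<sigma>) ` set affine5" .
  have "?\<sigma> \<circ> as_fun m \<circ> inv_into UNIV ?\<sigma> \<circ> ?\<sigma> = ?\<sigma> \<circ> as_fun m" for m
    by (simp only: comp_assoc permutes_inv_o(2)[OF \<sigma>] comp_id)
  then show "(\<lambda>\<gamma>. perm_act \<gamma> (theta a b c)) `
        generate (sym_group 5) {cycle_of_list [1, 2, a, b, c], cycle_of_list [2, a, c, b]} =
      (\<lambda>m. edge_value (zperm (?\<sigma> \<circ> as_fun m)) theta_edges :: 'k zpoly) ` set affine5"
    unfolding gen image_image theta_edge_value[OF abc]
    by (simp only: perm_act_zperm[where 'k = 'k, OF \<sigma> edges])
qed

lemma H0_value:
  assumes char: "(1::'k::field) \<noteq> -1" and abc: "{a, b, c} = {3, 4, 5}"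
  shows "(H0 a b c :: 'k zpoly) = value_of (zperm (as_fun [1, 2, a, b, c])) poly_H"
proof -
  have \<sigma>: "as_fun [1, 2, a, b, c] permutes {1..5}"
    using permutation_345(1)[OF abc] by (rule as_fun_permutes)
  have eta: "eta1 = (edge_value z (eta_edges ! 0) :: 'k zpoly)"
    "eta2 = (edge_value z (eta_edges ! 1) :: 'k zpoly)"
    "eta3 = (edge_value z (eta_edges ! 2) :: 'k zpoly)"
    "eta4 = (edge_value z (eta_edges ! 3) :: 'k zpoly)"
    "eta5 = (edge_value z (eta_edges ! 4) :: 'k zpoly)"
    by (simp_all add: edge_value_def eta_edges_def mult_ac
        eta1_def eta2_def eta3_def eta4_def eta5_def)
  have edges: "is_edge_list (eta_edges ! k)" if "k < 5" for k
  proof -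
    have "k \<in> {0, 1, 2, 3, 4}" using that by auto
    then show ?thesis by (auto simp: is_edge_list_def eta_edges_def)
  qed
  have pH: "poly_H = orbit_list perms5 (eta_edges ! 0) @ orbit_list perms5 (eta_edges ! 1) @
      orbit_list perms5 (eta_edges ! 2) @ orbit_list perms5 (eta_edges ! 3) @
      orbit_list perms5 (eta_edges ! 4) @ orbit_list affine5 theta_edges"
    by (simp add: poly_H_def eta_edges_def)
  show ?thesis
    unfolding H0_def eta pH using edges
    by (simp add: Q_value[OF char \<sigma>] U_value[OF char abc] add.assoc)
qed

section \<open>The Pfaffian ideal\<close>

definition pf :: "(nat \<Rightarrow> nat \<Rightarrow> 'r::comm_ring_1) \<Rightarrow> nat \<Rightarrow> 'r" where
  "pf x i = value_of x (poly_pf i)"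

lemma list_all_1_5: "list_all P [1..<6] \<Longrightarrow> i \<in> {1..5} \<Longrightarrow> P i"
  by (auto simp: list_all_iff)

lemma rot_mem: "rot k i \<in> {1..5}"
  unfolding rot_def by (simp add: less_Suc_eq_le[symmetric])

lemma wf_poly_pf [simp]: "wf_poly (poly_pf i)"
  by (simp add: poly_pf_def)

lemma homog_lift2: "i \<in> {1..5} \<Longrightarrow> j \<in> {1..5} \<Longrightarrow> homog_poly 6 (lift2 i j)"
  using list_all_1_5[OF homog_lift2_checked, of i]
  by (auto simp: homog_lift2_row_def list_all_iff)

lemma homog_pf: "i \<in> {1..5} \<Longrightarrow> homog_poly 2 (poly_pf i)"
  using homog_pf_checked by (auto simp: list_all_iff)

lemma homog_poly_H: "homog_poly 10 poly_H"
  using poly_H_checked by (simp add: poly_H_check_def)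

lemma wf_lift2: "i \<in> {1..5} \<Longrightarrow> j \<in> {1..5} \<Longrightarrow> wf_poly (lift2 i j)"
  using homog_poly_wf homog_lift2 by blast

lemma wf_poly_H: "wf_poly poly_H"
  using homog_poly_wf homog_poly_H by blast

lemma pf_pfaffian4:
  "skew x \<Longrightarrow> pf x i = pfaffian4 x (rot 1 i) (rot 2 i) (rot 3 i) (rot 4 i)"
  unfolding pf_def poly_pf_def by (intro value_of_pf4 rot_mem)

context
  fixes x :: "nat \<Rightarrow> nat \<Rightarrow> 'r::comm_ring_1"
  assumes char3: "(3::'r) = 0" and skew: "skew x"
begin

lemma tree_value_pf: "tree_value x (pf_tree i) = pf x i"
  by (simp add: pf_tree_def pf_def tree_value_of[OF char3])

lemma tree_value_var:
  "i \<in> {1..5} \<Longrightarrow> j \<in> {1..5} \<Longrightarrow> tree_value x (var_tree i j) = x i j"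
  by (simp only: var_tree_def tree_value_of[OF char3] wf_polyI value_of_var[OF skew])

lemma tree_value_cube: "tree_value x (tree_cube p) = tree_value x p ^ 3"
  by (simp add: tree_cube_def tree_value_mult[OF char3] power3_eq_cube mult_ac)

lemma pf_syzygy:
  assumes "i \<in> {1..5}"
  shows "(\<Sum>k=1..5. x i k * pf x k) = 0"
proof -
  have "tree_zero (tree_dot (map (var_tree i) [1..<6]) (map pf_tree [1..<6]))"
    using list_all_1_5[OF syzygy_checked assms] by (simp add: syzygy_check_def)
  then have "tree_value x (tree_dot (map (var_tree i) [1..<6]) (map pf_tree [1..<6])) = 0"
    unfolding tree_value_def by (rule tvalue_zero[OF char3])
  then show ?thesis
    unfolding tree_value_dot[OF char3] by (simp add: tree_value_var[OF assms] tree_value_pf)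
qed

text \<open>Row i and column j of \<open>Z L\<^sub>2 = L\<^sub>1 Z\<^sup>[\<^sup>3\<^sup>]\<close>.\<close>

lemma lift2_identity:
  assumes "i \<in> {1..5}" "j \<in> {1..5}"
  shows "(\<Sum>k=1..5. x i k * value_of x (lift2 k j)) = pf x i ^ 2 * x i j ^ 3"
proof -
  have "tree_eq (tree_dot (map (var_tree i) [1..<6]) (map (lift2_tree j) [1..<6]))
      (tree_mult (tree_mult (pf_tree i) (pf_tree i)) (tree_cube (var_tree i j)))"
    using list_all_1_5[OF list_all_1_5[OF lift2_checked assms(2), unfolded lift2_column_check_def]
        assms(1)]
    unfolding lift2_entry_check_def .
  from tree_value_eq[OF char3 this, of x] show ?thesis
    unfolding tree_value_dot[OF char3] tree_value_mult[OF char3] tree_value_cube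
    using assms by (simp add: tree_value_var tree_value_pf lift2_tree_def tree_value_of[OF char3]
        wf_lift2 power2_eq_square)
qed

text \<open>Row i of \<open>L\<^sub>2 (p\<^sup>[\<^sup>3\<^sup>])\<^sup>T = h p\<^sup>T\<close>.\<close>

lemma lift3_identity:
  assumes "i \<in> {1..5}"
  shows "(\<Sum>j=1..5. value_of x (lift2 i j) * pf x j ^ 3) = pf x i * value_of x poly_H"
proof -
  have "tree_eq (tree_dot (map (lift2_row_tree i) [1..<6]) (map pf_cube_tree [1..<6]))
      (tree_mult (pf_tree i) (tree_of poly_H))"
    using poly_H_checked list_all_1_5[OF _ assms, of "lift3_check (tree_of poly_H)"]
    unfolding poly_H_check_def lift3_check_def by blast
  from tree_value_eq[OF char3 this, of x] show ?thesis
    unfolding tree_value_dot[OF char3] tree_value_mult[OF char3] pf_cube_tree_def tree_value_cube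
    using assms by (simp add: tree_value_pf lift2_row_tree_def tree_value_of[OF char3] wf_lift2 wf_poly_H)
qed

lemma pfaffian4_pf:
  assumes "[i, j, k, l, m] \<in> set perms5"
  shows "pfaffian4 x i j k l = pf x m \<or> pfaffian4 x i j k l = - pf x m"
proof -
  have "pf4_check [i, j, k, l, m]"
    using pf4_checked assms by (auto simp: list_all_iff)
  then have "tree_eq (tree_of (poly_pf4 i j k l)) (pf_tree m) \<or>
      tree_eq (tree_of (poly_pf4 i j k l)) (tree_scale (-1) (pf_tree m))"
    by (simp add: pf4_check_def Let_def eval_nat_numeral)
  moreover have "tree_value x (tree_of (poly_pf4 i j k l)) = pfaffian4 x i j k l"
    using assms by (simp add: tree_value_of[OF char3] value_of_pf4[OF skew] perms5_iff)
  moreover have "tree_value x (tree_scale (-1) (pf_tree m)) = - pf x m"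
    using tree_value_pf by (simp add: tree_value_def tvalue_scale[OF char3])
  ultimately show ?thesis
    using tree_value_eq[OF char3] tree_value_pf by metis
qed

end

lemma char3_zpoly:
  assumes "(3::'k::comm_ring_1) = 0"
  shows "(3::'k zpoly) = 0"
  using assms by (metis single_numeral single_zero)

lemma perms5_permute:
  assumes "\<sigma> permutes {1..5}" "l \<in> set perms5"
  shows "map \<sigma> l \<in> set perms5"
  using assms permutes_in_image[OF assms(1)] permutes_inj_on[OF assms(1)]
  unfolding perms5_iff by (auto simp: distinct_map)

lemma perms5_complete:
  assumes "distinct [i, j, k, l]" "{i, j, k, l} \<subseteq> {1..5}"
  shows "\<exists>m. [i, j, k, l, m] \<in> set perms5"
proof -
  have "card {i, j, k, l} < card {1..5::nat}"
    using assms(1) by simp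
  then have "\<not> {1..5} \<subseteq> {i, j, k, l}"
    using card_mono[of "{i, j, k, l}" "{1..5::nat}"] by auto
  then obtain m where "m \<in> {1..5}" "m \<notin> {i, j, k, l}"
    by blast
  then show ?thesis
    using assms by (intro exI[of _ m]) (auto simp: perms5_iff)
qed

text \<open>A Pfaffian of the relabelled matrix is, up to sign, a Pfaffian of the generic matrix on four vertices in
increasing order.\<close>

lemma pf_mem_pfaffian_ideal:
  assumes char3: "(3::'k::comm_ring_1) = 0" and \<sigma>: "\<sigma> permutes {1..5}" and i: "i \<in> {1..5}"
  shows "pf (zperm \<sigma>) i \<in> (pfaffian_ideal :: 'k zpoly set)"
proof -
  interpret M: Modules.module "(*) :: 'k zpoly \<Rightarrow> 'k zpoly \<Rightarrow> 'k zpoly" by (rule module_mult)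
  let ?S = "{pfaffian4 z i j k l | i j k l. 1 \<le> i \<and> i < j \<and> j < k \<and> k < l \<and> l \<le> 5} :: 'k zpoly set"
  have zp: "zperm id = (z :: nat \<Rightarrow> nat \<Rightarrow> 'k zpoly)"
    by (simp add: zperm_def[abs_def])
  note sgn = pfaffian4_pf[OF char3_zpoly[OF char3] skew_zperm]
  have gen: "pf z m \<in> M.span ?S" if "m \<in> {1..5}" for m
  proof -
    have "\<exists>i j k l. 1 \<le> i \<and> i < j \<and> j < k \<and> k < l \<and> l \<le> 5 \<and> [i, j, k, l, m] \<in> set perms5"
    proof -
      have "m \<in> {1, 2, 3, 4, 5}" using that by auto
      then consider "m = 1" | "m = 2" | "m = 3" | "m = 4" | "m = 5" by blast
      then show ?thesis
      proof cases
        case 1 show ?thesis by (rule exI[of _ 2], rule exI[of _ 3], rule exI[of _ 4], rule exI[of _ 5]) (simp add: 1 perms5_iff)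
      next
        case 2 show ?thesis by (rule exI[of _ 1], rule exI[of _ 3], rule exI[of _ 4], rule exI[of _ 5]) (simp add: 2 perms5_iff)
      next
        case 3 show ?thesis by (rule exI[of _ 1], rule exI[of _ 2], rule exI[of _ 4], rule exI[of _ 5]) (simp add: 3 perms5_iff)
      next
        case 4 show ?thesis by (rule exI[of _ 1], rule exI[of _ 2], rule exI[of _ 3], rule exI[of _ 5]) (simp add: 4 perms5_iff)
      next
        case 5 show ?thesis by (rule exI[of _ 1], rule exI[of _ 2], rule exI[of _ 3], rule exI[of _ 4]) (simp add: 5 perms5_iff)
      qed
    qed
    then obtain i j k l where "pfaffian4 z i j k l \<in> ?S" "[i, j, k, l, m] \<in> set perms5"
      by blast
    then show ?thesis
      using sgn[of i j k l m id] M.span_base[of "pfaffian4 z i j k l" ?S] M.span_neg[of "- pf z m" ?S]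
      unfolding zp by auto
  qed
  have "[rot 1 i, rot 2 i, rot 3 i, rot 4 i, i] \<in> set perms5"
  proof -
    have "i \<in> {1, 2, 3, 4, 5}" using i by auto
    then show ?thesis by (elim insertE emptyE; simp add: perms5_iff rot_def)
  qed
  then have perm: "[\<sigma> (rot 1 i), \<sigma> (rot 2 i), \<sigma> (rot 3 i), \<sigma> (rot 4 i), \<sigma> i] \<in> set perms5"
    using perms5_permute[OF \<sigma>] by fastforce
  have "pf (zperm \<sigma>) i = (pfaffian4 z (\<sigma> (rot 1 i)) (\<sigma> (rot 2 i)) (\<sigma> (rot 3 i)) (\<sigma> (rot 4 i)) :: 'k zpoly)"
    by (simp add: pf_pfaffian4) (simp add: pfaffian4_def zperm_def)
  moreover have "pf z (\<sigma> i) \<in> M.span ?S"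
    using i permutes_in_image[OF \<sigma>] by (intro gen) simp
  ultimately have "pf (zperm \<sigma>) i \<in> M.span ?S"
    using sgn[OF perm, of id] M.span_neg[of "pf z (\<sigma> i)" ?S] unfolding zp by auto
  then show ?thesis
    unfolding pfaffian_ideal_def ideal_generated_def .
qed

text \<open>Conversely, undoing the relabelling shows that each generator of the ideal is, up to sign, a Pfaffian of the
relabelled matrix.\<close>

lemma pfaffian_ideal_combination:
  assumes char3: "(3::'k::comm_ring_1) = 0" and \<sigma>: "\<sigma> permutes {1..5}"
    and f: "f \<in> (pfaffian_ideal :: 'k zpoly set)"
  shows "\<exists>v. f = (\<Sum>i=1..5. pf (zperm \<sigma>) i * v i)"
proof -
  interpret M: Modules.module "(*) :: 'k zpoly \<Rightarrow> 'k zpoly \<Rightarrow> 'k zpoly" by (rule module_mult)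
  let ?S = "{pfaffian4 z i j k l | i j k l. 1 \<le> i \<and> i < j \<and> j < k \<and> k < l \<and> l \<le> 5} :: 'k zpoly set"
  let ?T = "{f. \<exists>v. f = (\<Sum>i=1..5. pf (zperm \<sigma>) i * v i)} :: 'k zpoly set"
  have "M.subspace ?T"
  proof (rule M.subspaceI)
    show "0 \<in> ?T" by (intro CollectI exI[of _ "\<lambda>_. 0"]) simp
    show "f + g \<in> ?T" if fg: "f \<in> ?T" "g \<in> ?T" for f g
    proof -
      obtain v w where "f = (\<Sum>i=1..5. pf (zperm \<sigma>) i * v i)" "g = (\<Sum>i=1..5. pf (zperm \<sigma>) i * w i)"
        using fg by blast
      then show ?thesis
        by (intro CollectI exI[of _ "\<lambda>i. v i + w i"]) (simp add: distrib_left sum.distrib)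
    qed
    show "c * f \<in> ?T" if f: "f \<in> ?T" for c f
    proof -
      obtain v where v: "f = (\<Sum>i=1..5. pf (zperm \<sigma>) i * v i)"
        using f by blast
      have "c * f = (\<Sum>i=1..5. pf (zperm \<sigma>) i * (c * v i))"
        unfolding v sum_distrib_left by (rule sum.cong) (simp_all only: mult.left_commute)
      then show ?thesis
        by (intro CollectI exI[of _ "\<lambda>i. c * v i"])
    qed
  qed
  moreover have "?S \<subseteq> ?T"
  proof
    fix g :: "'k zpoly" assume "g \<in> ?S"
    then obtain i j k l where g: "g = pfaffian4 z i j k l" and ijkl: "1 \<le> i" "i < j" "j < k" "k < l" "l \<le> 5"
      by blast
    obtain m where "[i, j, k, l, m] \<in> set perms5"
      using perms5_complete[of i j k l] ijkl by auto
    define \<rho> where "\<rho> = inv_into UNIV \<sigma>"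
    have \<rho>: "\<rho> permutes {1..5}" and \<sigma>\<rho>: "\<sigma> (\<rho> i) = i" for i
      using permutes_inv[OF \<sigma>] permutes_inverses(1)[OF \<sigma>] by (simp_all add: \<rho>_def)
    have perm: "[\<rho> i, \<rho> j, \<rho> k, \<rho> l, \<rho> m] \<in> set perms5"
      using perms5_permute[OF \<rho> \<open>[i, j, k, l, m] \<in> set perms5\<close>] by simp
    have "g = pfaffian4 (zperm \<sigma>) (\<rho> i) (\<rho> j) (\<rho> k) (\<rho> l)"
      by (simp add: g pfaffian4_def zperm_def \<sigma>\<rho>)
    then obtain s where s: "g = pf (zperm \<sigma>) (\<rho> m) * s"
      using pfaffian4_pf[OF char3_zpoly[OF char3] skew_zperm perm, of \<sigma>]
      by (metis mult.right_neutral mult_minus_right)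
    have "\<rho> m \<in> {1..5}"
      using perm by (simp add: perms5_iff)
    then show "g \<in> ?T"
      unfolding s by (intro CollectI exI[of _ "\<lambda>i. if i = \<rho> m then s else 0"]) (simp add: if_distrib cong: if_cong)
  qed
  ultimately have "M.span ?S \<subseteq> ?T"
    by (rule M.span_minimal[rotated])
  then show ?thesis
    using f unfolding pfaffian_ideal_def ideal_generated_def by blast
qed

section \<open>Constant matrices\<close>

definition homogeneous_mat :: "nat \<Rightarrow> 'k::comm_ring_1 zpoly mat \<Rightarrow> bool" where
  "homogeneous_mat n A \<longleftrightarrow> (\<forall>i<dim_row A. \<forall>j<dim_col A. homogeneous n (A $$ (i, j)))"

abbreviation const_mat :: "'k::comm_ring_1 mat \<Rightarrow> 'k zpoly mat" where
  "const_mat \<equiv> map_mat const"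

abbreviation cube_mat :: "'r::comm_ring_1 mat \<Rightarrow> 'r mat" where
  "cube_mat \<equiv> map_mat (\<lambda>f. f ^ 3)"

lemma homogeneous_mat_mult:
  assumes "homogeneous_mat n A" "homogeneous_mat k B" "dim_col A = dim_row B"
  shows "homogeneous_mat (n + k) (A * B)"
  unfolding homogeneous_mat_def
proof (intro allI impI)
  fix i j assume "i < dim_row (A * B)" "j < dim_col (A * B)"
  then have "(A * B) $$ (i, j) = (\<Sum>l = 0..<dim_row B. A $$ (i, l) * B $$ (l, j))"
    using assms(3) by (simp add: scalar_prod_def)
  also have "homogeneous (n + k) \<dots>"
    using assms \<open>i < _\<close> \<open>j < _\<close> by (intro homogeneous_sum homogeneous_mult) (auto simp: homogeneous_mat_def)
  finally show "homogeneous (n + k) ((A * B) $$ (i, j))" .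
qed

lemma homogeneous_mat_const [simp]: "homogeneous_mat 0 (const_mat A)"
  by (simp add: homogeneous_mat_def)

lemma homogeneous_mat_cube: "homogeneous_mat n A \<Longrightarrow> homogeneous_mat (3 * n) (cube_mat A)"
  by (simp add: homogeneous_mat_def homogeneous_power)

lemma graded_map_replicate:
  assumes "t \<le> s"
  shows "graded_map (replicate m s) (replicate n t) A \<longleftrightarrow>
    A \<in> carrier_mat n m \<and> homogeneous_mat (s - t) A"
proof -
  have "mono_degree k + t = s \<longleftrightarrow> mono_degree k = s - t" for k
    using assms by auto
  then show ?thesis
    by (auto simp: graded_map_def homogeneous_mat_def homogeneous_def)
qed

interpretation const: comm_ring_hom "const :: 'k::comm_ring_1 \<Rightarrow> 'k zpoly"
  by unfold_locales (simp_all add: single_add mult_single)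

text \<open>The Frobenius endomorphism; it makes the entrywise cube of matrices multiplicative.\<close>

lemma cube_comm_ring_hom:
  assumes "(3::'r::comm_ring_1) = 0"
  shows "comm_ring_hom (\<lambda>f::'r. f ^ 3)"
  by unfold_locales (simp_all add: cube_add[OF assms] power_mult_distrib)

lemma cube_mat_mult:
  assumes "(3::'r::comm_ring_1) = 0" "A \<in> carrier_mat n m" "B \<in> carrier_mat m (k::nat)"
  shows "cube_mat (A * B :: 'r mat) = cube_mat A * cube_mat B"
proof -
  interpret comm_ring_hom "\<lambda>f::'r. f ^ 3" by (rule cube_comm_ring_hom[OF assms(1)])
  show ?thesis using assms(2,3) by (rule mat_hom_mult)
qed

lemma cube_mat_one:
  assumes "(3::'r::comm_ring_1) = 0"
  shows "cube_mat (1\<^sub>m n :: 'r mat) = 1\<^sub>m n"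
proof -
  interpret comm_ring_hom "\<lambda>f::'r. f ^ 3" by (rule cube_comm_ring_hom[OF assms(1)])
  show ?thesis by (rule mat_hom_one)
qed

lemma const_mat_zero [simp]: "const_mat (0\<^sub>m n m) = 0\<^sub>m n m"
  by (intro eq_matI) auto

text \<open>If the columns of \<open>M\<close> lie in the image of \<open>D\<close>, and the two matrices have the same degree, then they are
combinations of the columns of \<open>D\<close> with constant coefficients: only the constant terms of the coefficients
contribute in that degree.\<close>

lemma constant_factor:
  fixes D M :: "'k::comm_ring_1 zpoly mat"
  assumes D: "D \<in> carrier_mat r n" "homogeneous_mat a D"
    and M: "M \<in> carrier_mat r m" "homogeneous_mat a M"
    and img: "\<And>j. j < m \<Longrightarrow> col M j \<in> mat_image D"
  obtains K where "K \<in> carrier_mat n m" "M = D * const_mat K"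
proof -
  have "\<forall>j. \<exists>v. j < m \<longrightarrow> v \<in> carrier_vec n \<and> col M j = D *\<^sub>v v"
    using img D(1) unfolding mat_image_def by auto
  then obtain v where v: "\<And>j. j < m \<Longrightarrow> v j \<in> carrier_vec n" "\<And>j. j < m \<Longrightarrow> col M j = D *\<^sub>v v j"
    by metis
  define K where "K = mat n m (\<lambda>(i, j). Poly_Mapping.lookup (v j $ i) 0)"
  have "M = D * const_mat K"
  proof (rule eq_matI)
    fix i j assume "i < dim_row (D * const_mat K)" "j < dim_col (D * const_mat K)"
    then have ij: "i < r" "j < m"
      using D(1) by (simp_all add: K_def)
    have "M $$ (i, j) = (D *\<^sub>v v j) $ i"
      using ij M(1) v(2)[of j] by (metis carrier_matD index_col)
    then have lhs: "M $$ (i, j) = (\<Sum>l = 0..<n. D $$ (i, l) * v j $ l)"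
      using ij D(1) v(1)[of j] by (simp add: scalar_prod_def)
    have rhs: "(D * const_mat K) $$ (i, j) =
        (\<Sum>l = 0..<n. D $$ (i, l) * const (Poly_Mapping.lookup (v j $ l) 0))"
      using ij D(1) by (simp add: scalar_prod_def K_def)
    have hom: "homogeneous a (D $$ (i, l))" if "l < n" for l
      using that ij D by (auto simp: homogeneous_mat_def)
    show "M $$ (i, j) = (D * const_mat K) $$ (i, j)"
    proof (rule poly_mapping_eqI)
      fix k
      show "Poly_Mapping.lookup (M $$ (i, j)) k = Poly_Mapping.lookup ((D * const_mat K) $$ (i, j)) k"
      proof (cases "mono_degree k = a")
        case True
        then show ?thesis
          unfolding lhs rhs lookup_sum
          by (intro sum.cong refl) (simp add: lookup_mult_homogeneous[OF hom] lookup_mult_const)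
      next
        case False
        have "homogeneous a (M $$ (i, j))"
          using ij M by (auto simp: homogeneous_mat_def)
        moreover have "homogeneous (a + 0) ((D * const_mat K) $$ (i, j))"
          unfolding rhs by (intro homogeneous_sum homogeneous_mult homogeneous_const) (simp add: hom)
        ultimately show ?thesis
          using False by (simp add: homogeneous_lookup)
      qed
    qed
  qed (use D(1) M(1) in \<open>simp_all add: K_def\<close>)
  then show thesis
    by (intro that[of K]) (simp_all add: K_def)
qed

section \<open>The Buchsbaum--Eisenbud complex\<close>

definition pf_row :: "(nat \<Rightarrow> nat \<Rightarrow> 'r::comm_ring_1) \<Rightarrow> 'r mat" where
  "pf_row x = mat 1 5 (\<lambda>(i, j). pf x (Suc j))"

definition skew_mat :: "(nat \<Rightarrow> nat \<Rightarrow> 'r::comm_ring_1) \<Rightarrow> 'r mat" where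
  "skew_mat x = mat 5 5 (\<lambda>(i, j). x (Suc i) (Suc j))"

definition pf_col :: "(nat \<Rightarrow> nat \<Rightarrow> 'r::comm_ring_1) \<Rightarrow> 'r mat" where
  "pf_col x = mat 5 1 (\<lambda>(i, j). pf x (Suc i))"

text \<open>The first two components of the chain map from the Frobenius power of the complex with
differentials \<open>pf_row\<close>, \<open>skew_mat\<close> and \<open>pf_col\<close>.\<close>

definition lift1_mat :: "(nat \<Rightarrow> nat \<Rightarrow> 'r::comm_ring_1) \<Rightarrow> 'r mat" where
  "lift1_mat x = mat 5 5 (\<lambda>(i, j). if i = j then pf x (Suc i) ^ 2 else 0)"

definition lift2_mat :: "(nat \<Rightarrow> nat \<Rightarrow> 'r::comm_ring_1) \<Rightarrow> 'r mat" where
  "lift2_mat x = mat 5 5 (\<lambda>(i, j). value_of x (lift2 (Suc i) (Suc j)))"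

lemma standard_carrier:
  "pf_row x \<in> carrier_mat 1 5" "skew_mat x \<in> carrier_mat 5 5" "pf_col x \<in> carrier_mat 5 1"
  "lift1_mat x \<in> carrier_mat 5 5" "lift2_mat x \<in> carrier_mat 5 5"
  by (simp_all add: pf_row_def skew_mat_def pf_col_def lift1_mat_def lift2_mat_def)

lemmas standard_dims [simp] =
  standard_carrier standard_carrier(1,3)[unfolded One_nat_def]
  standard_carrier[THEN carrier_matD(1)] standard_carrier[THEN carrier_matD(2)]

lemma sum_Suc_5: "(\<Sum>k = 0..<5. f (Suc k)) = (\<Sum>k = 1..5. f k)"
  by (simp add: sum.atLeast1_atMost_eq lessThan_atLeast0)

context
  fixes x :: "nat \<Rightarrow> nat \<Rightarrow> 'r::comm_ring_1"
  assumes char3: "(3::'r) = 0" and skew: "skew x"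
begin

lemma skew_mat_pf_col: "skew_mat x * pf_col x = 0\<^sub>m 5 1"
proof (rule eq_matI)
  fix i j assume "i < dim_row (0\<^sub>m 5 1 :: 'r mat)" "j < dim_col (0\<^sub>m 5 1 :: 'r mat)"
  then show "(skew_mat x * pf_col x) $$ (i, j) = 0\<^sub>m 5 1 $$ (i, j)"
    using pf_syzygy[OF char3 skew, of "Suc i"]
    by (simp add: skew_mat_def pf_col_def scalar_prod_def sum_Suc_5[where f = "\<lambda>k. x (Suc i) k * pf x k", simplified])
qed (simp_all add: skew_mat_def pf_col_def)

lemma pf_row_skew_mat: "pf_row x * skew_mat x = 0\<^sub>m 1 5"
proof (rule eq_matI)
  fix i j assume ij: "i < dim_row (0\<^sub>m 1 5 :: 'r mat)" "j < dim_col (0\<^sub>m 1 5 :: 'r mat)"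
  have "(\<Sum>k=1..5. pf x k * x k (Suc j)) = (\<Sum>k=1..5. - (x (Suc j) k * pf x k))"
    by (rule sum.cong) (simp_all add: skewD(2)[OF skew, of "Suc j"])
  also have "\<dots> = 0"
    using pf_syzygy[OF char3 skew, of "Suc j"] ij by (simp add: sum_negf)
  finally show "(pf_row x * skew_mat x) $$ (i, j) = 0\<^sub>m 1 5 $$ (i, j)"
    using ij by (simp add: skew_mat_def pf_row_def scalar_prod_def
        sum_Suc_5[where f = "\<lambda>k. pf x k * x k (Suc j)", simplified])
qed (simp_all add: skew_mat_def pf_row_def)

lemma pf_row_lift1: "pf_row x * lift1_mat x = cube_mat (pf_row x)"
proof (rule eq_matI)
  fix i j assume ij: "i < dim_row (cube_mat (pf_row x))" "j < dim_col (cube_mat (pf_row x))"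
  then have "(pf_row x * lift1_mat x) $$ (i, j) = pf x (Suc j) * pf x (Suc j) ^ 2"
    by (simp add: pf_row_def lift1_mat_def scalar_prod_def if_distrib cong: if_cong)
  then show "(pf_row x * lift1_mat x) $$ (i, j) = cube_mat (pf_row x) $$ (i, j)"
    using ij by (simp add: pf_row_def power2_eq_square power3_eq_cube mult_ac)
qed (simp_all add: pf_row_def lift1_mat_def)

lemma skew_mat_lift2: "skew_mat x * lift2_mat x = lift1_mat x * cube_mat (skew_mat x)"
proof (rule eq_matI)
  fix i j assume "i < dim_row (lift1_mat x * cube_mat (skew_mat x))"
    "j < dim_col (lift1_mat x * cube_mat (skew_mat x))"
  then have ij: "i < 5" "j < 5"
    by (simp_all add: lift1_mat_def skew_mat_def)
  have "(lift1_mat x * cube_mat (skew_mat x)) $$ (i, j) =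
      pf x (Suc i) ^ 2 * x (Suc i) (Suc j) ^ 3"
    using ij by (simp add: skew_mat_def lift1_mat_def scalar_prod_def
        if_distrib[where f = "\<lambda>y. y * _"] cong: if_cong)
  also have "\<dots> = (\<Sum>k=1..5. x (Suc i) k * value_of x (lift2 k (Suc j)))"
    using lift2_identity[OF char3 skew, of "Suc i" "Suc j"] ij by simp
  also have "\<dots> = (skew_mat x * lift2_mat x) $$ (i, j)"
    using ij by (simp add: skew_mat_def lift2_mat_def scalar_prod_def
        sum_Suc_5[where f = "\<lambda>k. x (Suc i) k * value_of x (lift2 k (Suc j))", simplified])
  finally show "(skew_mat x * lift2_mat x) $$ (i, j) =
      (lift1_mat x * cube_mat (skew_mat x)) $$ (i, j)" by simp
qed (simp_all add: skew_mat_def lift1_mat_def lift2_mat_def)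

lemma lift2_pf_col: "lift2_mat x * cube_mat (pf_col x) = value_of x poly_H \<cdot>\<^sub>m pf_col x"
proof (rule eq_matI)
  fix i j assume "i < dim_row (value_of x poly_H \<cdot>\<^sub>m pf_col x)" "j < dim_col (value_of x poly_H \<cdot>\<^sub>m pf_col x)"
  then have ij: "i < 5" "j < 1"
    by (simp_all add: pf_col_def)
  then have "(lift2_mat x * cube_mat (pf_col x)) $$ (i, j) =
      (\<Sum>k=1..5. value_of x (lift2 (Suc i) k) * pf x k ^ 3)"
    by (simp add: pf_col_def lift2_mat_def scalar_prod_def
        sum_Suc_5[where f = "\<lambda>k. value_of x (lift2 (Suc i) k) * pf x k ^ 3", simplified])
  also have "\<dots> = pf x (Suc i) * value_of x poly_H"
    using ij by (intro lift3_identity[OF char3 skew]) simp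
  finally show "(lift2_mat x * cube_mat (pf_col x)) $$ (i, j) = (value_of x poly_H \<cdot>\<^sub>m pf_col x) $$ (i, j)"
    using ij by (simp add: pf_col_def mult.commute)
qed (simp_all add: pf_col_def lift2_mat_def)

end

lemma standard_homogeneous:
  assumes "\<sigma> permutes {1..5}"
  shows "homogeneous_mat 2 (pf_row (zperm \<sigma>) :: 'k::comm_ring_1 zpoly mat)"
    and "homogeneous_mat 1 (skew_mat (zperm \<sigma>) :: 'k zpoly mat)"
    and "homogeneous_mat 2 (pf_col (zperm \<sigma>) :: 'k zpoly mat)"
    and "homogeneous_mat 4 (lift1_mat (zperm \<sigma>) :: 'k zpoly mat)"
    and "homogeneous_mat 6 (lift2_mat (zperm \<sigma>) :: 'k zpoly mat)"
proof -
  have pf: "homogeneous 2 (pf (zperm \<sigma>) (Suc i) :: 'k zpoly)" if "i < 5" for i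
    unfolding pf_def using that by (intro homogeneous_value_of[OF assms] homog_pf) simp
  show "homogeneous_mat 2 (pf_row (zperm \<sigma>) :: 'k zpoly mat)"
    and "homogeneous_mat 2 (pf_col (zperm \<sigma>) :: 'k zpoly mat)"
    by (simp_all add: homogeneous_mat_def pf_row_def pf_col_def pf)
  show "homogeneous_mat 4 (lift1_mat (zperm \<sigma>) :: 'k zpoly mat)"
    using homogeneous_power[OF pf, of _ 2] by (simp add: homogeneous_mat_def lift1_mat_def)
  show "homogeneous_mat 6 (lift2_mat (zperm \<sigma>) :: 'k zpoly mat)"
    unfolding homogeneous_mat_def lift2_mat_def
    by (auto intro!: homogeneous_value_of[OF assms] homog_lift2)
  have "homogeneous 1 (zX v :: 'k zpoly)" for v
    unfolding zX_def by (rule homogeneous_single) simp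
  then have "homogeneous 1 (z i j :: 'k zpoly)" for i j
    by (auto simp: z_def homogeneous_def)
  then show "homogeneous_mat 1 (skew_mat (zperm \<sigma>) :: 'k zpoly mat)"
    by (simp add: homogeneous_mat_def skew_mat_def zperm_def)
qed

lemma nth_1_5:
  assumes eq: "map f [1..<6] = (replicate 5 0)[i - 1 := u]" and i: "i \<in> {1..5}" and j: "j \<in> {1..5}"
  shows "f j = (if i = j then u else 0)"
proof -
  have "f j = map f [1..<6] ! (j - 1)"
    using j by (cases j) simp_all
  also have "\<dots> = (replicate 5 0)[i - 1 := u] ! (j - 1)"
    by (rule arg_cong[OF eq])
  also have "\<dots> = (if i = j then u else 0)"
    using i j by (auto simp: nth_list_update)
  finally show ?thesis .
qed

lemma pf_row_independent:
  fixes K :: "'k::comm_ring_1 mat"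
  assumes \<sigma>: "\<sigma> permutes {1..5}" and K: "K \<in> carrier_mat 5 n"
    and eq: "pf_row (zperm \<sigma>) * const_mat K = 0\<^sub>m 1 n"
  shows "K = 0\<^sub>m 5 n"
proof (rule eq_matI)
  fix i j assume "i < dim_row (0\<^sub>m 5 n :: 'k mat)" "j < dim_col (0\<^sub>m 5 n :: 'k mat)"
  then have ij: "i < 5" "j < n" by simp_all
  then have i: "Suc i \<in> {1..5}" by simp
  let ?t = "hd (poly_pf (Suc i))"
  have t: "poly_pf (Suc i) \<noteq> []" "fst ?t = 1 \<or> fst ?t = -1"
    using pf_hd_checked i by (auto simp: list_all_iff)
  have "(\<Sum>k=1..5. value_of (zperm \<sigma>) (poly_pf k) * const (K $$ (k - 1, j))) =
      (pf_row (zperm \<sigma>) * const_mat K) $$ (0, j)"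
    using ij K by (simp add: pf_row_def pf_def scalar_prod_def
        sum_Suc_5[where f = "\<lambda>k. value_of (zperm \<sigma>) (poly_pf k) * const (K $$ (k - 1, j))", simplified])
  then have "(\<Sum>k=1..5. value_of (zperm \<sigma>) (poly_pf k) * const (K $$ (k - 1, j))) = 0"
    using eq ij by simp
  moreover have "length (snd ?t) = 10"
    using t(1) wf_poly_pf[of "Suc i"] by (simp add: wf_poly_def del: wf_poly_pf)
  moreover have "poly_coeff (poly_pf k) (snd ?t) = (if Suc i = k then fst ?t else 0)" if "k \<in> {1..5}" for k
    using list_all_1_5[OF pf_coeff_checked i] nth_1_5[OF _ i that, of "\<lambda>k. poly_coeff (poly_pf k) (snd ?t)"]
    by (simp add: pf_coeff_row_def comp_def)
  ultimately have "K $$ (Suc i - 1, j) = 0"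
    using t(2) i by (intro independent_by_coeff[OF \<sigma>, where J = "{1..5}" and i = "Suc i" and p = poly_pf
          and e = "snd ?t" and u = "fst ?t" and c = "\<lambda>k. K $$ (k - 1, j)"]) simp_all
  then show "K $$ (i, j) = 0\<^sub>m 5 n $$ (i, j)"
    using ij by simp
qed (use K in simp_all)

lemma skew_mat_independent:
  fixes K :: "'k::comm_ring_1 mat"
  assumes \<sigma>: "\<sigma> permutes {1..5}" and K: "K \<in> carrier_mat 5 n"
    and eq: "skew_mat (zperm \<sigma>) * const_mat K = 0\<^sub>m 5 n"
  shows "K = 0\<^sub>m 5 n"
proof (rule eq_matI)
  fix i j assume "i < dim_row (0\<^sub>m 5 n :: 'k mat)" "j < dim_col (0\<^sub>m 5 n :: 'k mat)"
  then have ij: "i < 5" "j < n" by simp_all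
  then have i: "Suc i \<in> {1..5}" by simp
  define r where "r = rot 1 (Suc i)"
  have r: "r \<in> {1..5}"
    unfolding r_def by (rule rot_mem)
  \<comment> \<open>in row \<open>r\<close> the column \<open>Suc i\<close> has an entry off the diagonal, that is, a variable\<close>
  then obtain q where q: "r = Suc q" "q < 5"
    by (cases r) simp_all
  let ?t = "sm_power r (Suc i) 1"
  have "(\<Sum>k=1..5. value_of (zperm \<sigma>) (poly_var r k) * const (K $$ (k - 1, j))) =
      (\<Sum>k=1..5. zperm \<sigma> r k * const (K $$ (k - 1, j)))"
    by (rule sum.cong) (simp_all only: value_of_var[OF skew_zperm r])
  also have "\<dots> = (skew_mat (zperm \<sigma>) * const_mat K) $$ (q, j)"
    using ij q K by (simp add: skew_mat_def scalar_prod_def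
        sum_Suc_5[where f = "\<lambda>k. zperm \<sigma> (Suc q) k * const (K $$ (k - 1, j))", simplified])
  also have "\<dots> = 0"
    using eq ij q by simp
  finally have "(\<Sum>k=1..5. value_of (zperm \<sigma>) (poly_var r k) * const (K $$ (k - 1, j))) = 0" .
  moreover have "poly_coeff (poly_var r k) (snd ?t) = (if Suc i = k then fst ?t else 0)" if "k \<in> {1..5}" for k
    using list_all_1_5[OF var_coeff_checked i] nth_1_5[OF _ i that, of "\<lambda>k. poly_coeff (poly_var r k) (snd ?t)"]
    by (simp add: var_coeff_row_def comp_def r_def)
  moreover have "fst ?t = 1 \<or> fst ?t = -1"
    by (simp add: sm_power_def)
  ultimately have "K $$ (Suc i - 1, j) = 0"
    using i by (intro independent_by_coeff[OF \<sigma>, where J = "{1..5}" and i = "Suc i" and p = "poly_var r"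
          and e = "snd ?t" and u = "fst ?t" and c = "\<lambda>k. K $$ (k - 1, j)"]) simp_all
  then show "K $$ (i, j) = 0\<^sub>m 5 n $$ (i, j)"
    using ij by simp
qed (use K in simp_all)

section \<open>Comparison with an arbitrary minimal resolution\<close>

lemma col_in_image:
  assumes "A \<in> carrier_mat r n" "j < n"
  shows "col A j \<in> mat_image A"
proof -
  have "col A j = A *\<^sub>v col (1\<^sub>m n) j"
    using assms by (metis col_mult2 one_carrier_mat right_mult_one_mat)
  then show ?thesis
    using assms unfolding mat_image_def by (auto intro!: image_eqI[of _ _ "col (1\<^sub>m n) j"])
qed

lemma col_in_kernel:
  assumes "A \<in> carrier_mat r n" "M \<in> carrier_mat n m" "A * M = 0\<^sub>m r m" "j < m"
  shows "col M j \<in> mat_kernel A"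
proof (rule mat_kernelI[OF assms(1)])
  have "A *\<^sub>v col M j = col (A * M) j"
    using col_mult2[OF assms(1,2,4)] by simp
  then show "A *\<^sub>v col M j = 0\<^sub>v r"
    using assms by simp
qed (use assms in simp)

lemma independent_cancel:
  fixes M :: "'k::comm_ring_1 zpoly mat"
  assumes M: "M \<in> carrier_mat r n"
    and ind: "\<And>K. K \<in> carrier_mat n m \<Longrightarrow> M * const_mat K = 0\<^sub>m r m \<Longrightarrow> K = 0\<^sub>m n m"
    and K: "K \<in> carrier_mat n m" and L: "L \<in> carrier_mat n m" and eq: "M * const_mat K = M * const_mat L"
  shows "K = L"
proof -
  have "const_mat (K - L) = const_mat K - const_mat L"
    using K L by (intro eq_matI) (auto simp: single_diff)
  then have "M * const_mat (K - L) = M * const_mat K - M * const_mat L"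
    using M K L by (simp add: mult_minus_distrib_mat)
  also have "\<dots> = 0\<^sub>m r m"
    unfolding eq using M L by (intro eq_matI) auto
  finally have "K - L = 0\<^sub>m n m"
    using K L by (intro ind) auto
  then have "\<And>i j. i < n \<Longrightarrow> j < m \<Longrightarrow> (K - L) $$ (i, j) = 0"
    by simp
  then show ?thesis
    using K L by (intro eq_matI) auto
qed

lemma inverse_of_injective:
  fixes K :: "'k::field mat"
  assumes K: "K \<in> carrier_mat n n"
    and inj: "\<And>V. V \<in> carrier_mat n 1 \<Longrightarrow> K * V = 0\<^sub>m n 1 \<Longrightarrow> V = 0\<^sub>m n 1"
  obtains L where "L \<in> carrier_mat n n" "K * L = 1\<^sub>m n" "L * K = 1\<^sub>m n"
proof -
  have "det K \<noteq> 0"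
  proof
    assume "det K = 0"
    then obtain v where v: "v \<in> carrier_vec n" "v \<noteq> 0\<^sub>v n" "K *\<^sub>v v = 0\<^sub>v n"
      using det_0_iff_vec_prod_zero_field[OF K] by blast
    define V where "V = mat_of_cols n [v]"
    have V: "V \<in> carrier_mat n 1" "col V 0 = v"
      using v(1) by (auto simp: V_def)
    have "K * V = 0\<^sub>m n 1"
    proof (rule eq_matI)
      fix i j assume ij: "i < dim_row (0\<^sub>m n 1 :: 'k mat)" "j < dim_col (0\<^sub>m n 1 :: 'k mat)"
      then have "(K * V) $$ (i, j) = (K *\<^sub>v v) $ i"
        using K V by simp
      then show "(K * V) $$ (i, j) = 0\<^sub>m n 1 $$ (i, j)"
        using ij v(3) by simp
    qed (use K V in simp_all)
    then have "V = 0\<^sub>m n 1"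
      using inj V by blast
    then show False
      using V(2) v(2) by auto
  qed
  then have "K \<in> Units (ring_mat TYPE('k) n ())"
    by (rule det_non_zero_imp_unit[OF K])
  then show thesis
    using that by (auto simp: Units_def ring_mat_simps)
qed

lemma assoc3:
  assumes "A \<in> carrier_mat n1 n2" "B \<in> carrier_mat n2 n3" "C \<in> carrier_mat n3 n4"
  shows "A * (B * C) = A * B * (C :: 'r::semiring_0 mat)"
  using assms by simp

text \<open>The maps to \<open>d\<close> exist because its kernels are images, and are constant for reasons of degree. They are
invertible, in degree 1 because both rows generate the ideal and the \<open>p\<^sub>i\<close> are independent, in degree 2
because the columns of \<open>Z\<close> are independent, and in degree 3 because \<open>p\<close> is not zero.\<close>

lemma resolution_comparison:
  fixes d :: "nat \<Rightarrow> 'k::field zpoly mat"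
  assumes char3: "(3::'k) = 0" and \<sigma>: "\<sigma> permutes {1..5}"
    and res: "minimal_graded_free_resolution pfaffian_ideal pfaffian_twists d"
  obtains A B C D :: "'k mat" and g :: 'k
  where "A \<in> carrier_mat 5 5" "B \<in> carrier_mat 5 5" "C \<in> carrier_mat 5 5" "D \<in> carrier_mat 5 5"
    and "A * B = 1\<^sub>m 5" "D * C = 1\<^sub>m 5" "g \<noteq> 0"
    and "d 0 * const_mat B = pf_row (zperm \<sigma>)" "d 0 = pf_row (zperm \<sigma>) * const_mat A"
    and "d 1 * const_mat C = const_mat B * skew_mat (zperm \<sigma>)"
    and "d 1 = const_mat B * skew_mat (zperm \<sigma>) * const_mat D"
    and "const g \<cdot>\<^sub>m d 2 = const_mat C * pf_col (zperm \<sigma>)"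
proof -
  let ?x = "zperm \<sigma> :: nat \<Rightarrow> nat \<Rightarrow> 'k zpoly"
  let ?P = "pf_row ?x" and ?Z = "skew_mat ?x" and ?p = "pf_col ?x"
  note char3' = char3_zpoly[OF char3]
  note hom = standard_homogeneous[OF \<sigma>, where 'k = 'k]
  have gm: "graded_map (pfaffian_twists (Suc n)) (pfaffian_twists n) (d n)"
    and ker: "mat_kernel (d n) = mat_image (d (Suc n))" for n
    using res by (simp_all add: minimal_graded_free_resolution_def)
  have im0: "mat_image (d 0) = {v \<in> carrier_vec 1. v $ 0 \<in> pfaffian_ideal}"
    using res by (simp add: minimal_graded_free_resolution_def)
  have "graded_map (replicate 5 2) (replicate 1 0) (d 0)"
    using gm[of 0] by (simp add: pfaffian_twists_def)
  then have d0: "d 0 \<in> carrier_mat 1 5" "homogeneous_mat 2 (d 0)"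
    by (simp_all only: graded_map_replicate le0 diff_zero)
  have "graded_map (replicate 5 3) (replicate 5 2) (d 1)"
    using gm[of 1] by (simp add: pfaffian_twists_def numeral_2_eq_2)
  then have d1: "d 1 \<in> carrier_mat 5 5" "homogeneous_mat 1 (d 1)"
    by (simp_all add: graded_map_replicate)
  have "graded_map (replicate 1 5) (replicate 5 3) (d 2)"
    using gm[of 2] by (simp add: pfaffian_twists_def)
  then have d2: "d 2 \<in> carrier_mat 5 1" "homogeneous_mat 2 (d 2)"
    by (subst (asm) graded_map_replicate; simp)+

  obtain B where B: "B \<in> carrier_mat 5 5" and dB: "?P = d 0 * const_mat B"
  proof (rule constant_factor[OF d0 standard_carrier(1) hom(1)])
    fix j :: nat assume "j < 5"
    then show "col ?P j \<in> mat_image (d 0)"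
      unfolding im0 using pf_mem_pfaffian_ideal[OF char3 \<sigma>, of "Suc j"]
      by (simp add: pf_row_def)
  qed
  obtain A where A: "A \<in> carrier_mat 5 5" and dA: "d 0 = ?P * const_mat A"
  proof (rule constant_factor[OF standard_carrier(1) hom(1) d0])
    fix j :: nat assume j: "j < 5"
    have col: "col (d 0) j \<in> {v \<in> carrier_vec 1. v $ 0 \<in> pfaffian_ideal}"
      using col_in_image[OF d0(1) j] im0 by simp
    then obtain v where v: "col (d 0) j $ 0 = (\<Sum>i=1..5. pf ?x i * v i)"
      using pfaffian_ideal_combination[OF char3 \<sigma>] by blast
    have "col (d 0) j = ?P *\<^sub>v vec 5 (\<lambda>i. v (Suc i))"
    proof (rule eq_vecI)
      fix i assume "i < dim_vec (?P *\<^sub>v vec 5 (\<lambda>i. v (Suc i)))"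
      then have "i = 0" by (simp add: pf_row_def)
      then show "col (d 0) j $ i = (?P *\<^sub>v vec 5 (\<lambda>i. v (Suc i))) $ i"
        using v by (simp add: pf_row_def scalar_prod_def
            sum_Suc_5[where f = "\<lambda>i. pf ?x i * v i", simplified])
    qed (use d0(1) in \<open>simp add: pf_row_def\<close>)
    then show "col (d 0) j \<in> mat_image ?P"
      unfolding mat_image_def by (intro image_eqI[of _ _ "vec 5 (\<lambda>i. v (Suc i))"]) (simp_all add: pf_row_def)
  qed
  have PAB: "?P * const_mat (A * B) = ?P * const_mat (1\<^sub>m 5)"
  proof -
    have "?P * const_mat (A * B) = ?P * (const_mat A * const_mat B)"
      using A B by (simp add: const.mat_hom_mult[of _ 5 5 _ 5])
    also have "\<dots> = ?P * const_mat A * const_mat B"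
      using A B by (intro assoc3[of _ 1 5 _ 5 _ 5]) simp_all
    also have "\<dots> = ?P"
      using dA dB by simp
    finally show ?thesis
      by (simp add: const.mat_hom_one right_mult_one_mat[OF standard_carrier(1)])
  qed
  have AB: "A * B = 1\<^sub>m 5"
    by (rule independent_cancel[OF standard_carrier(1) pf_row_independent[OF \<sigma>]
          mult_carrier_mat[OF A B] one_carrier_mat PAB])
  have cAB: "const_mat A * const_mat B = 1\<^sub>m 5"
    using AB const.mat_hom_mult[OF A B] by (simp add: const.mat_hom_one)

  have BZ: "const_mat B * ?Z \<in> carrier_mat 5 5" "homogeneous_mat 1 (const_mat B * ?Z)"
    using homogeneous_mat_mult[OF homogeneous_mat_const hom(2), of B, unfolded add_0_left] B
    by (simp_all add: skew_mat_def)
  have "d 0 * (const_mat B * ?Z) = d 0 * const_mat B * ?Z"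
    using d0 B by (intro assoc3[of _ 1 5 _ 5 _ 5]) simp_all
  then have zero0: "d 0 * (const_mat B * ?Z) = 0\<^sub>m 1 5"
    using pf_row_skew_mat[OF char3' skew_zperm[of \<sigma>]] by (simp flip: dB)
  obtain C where C: "C \<in> carrier_mat 5 5" and dC: "const_mat B * ?Z = d 1 * const_mat C"
  proof (rule constant_factor[OF d1 BZ])
    fix j :: nat assume "j < 5"
    then show "col (const_mat B * ?Z) j \<in> mat_image (d 1)"
      using col_in_kernel[OF d0(1) BZ(1) zero0] ker[of 0] by simp
  qed
  obtain D where D: "D \<in> carrier_mat 5 5" and CD: "C * D = 1\<^sub>m 5" "D * C = 1\<^sub>m 5"
  proof (rule inverse_of_injective[OF C])
    fix V :: "'k mat" assume V: "V \<in> carrier_mat 5 1" "C * V = 0\<^sub>m 5 1"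
    \<comment> \<open>\<open>C\<close> is injective: \<open>A\<close> inverts \<open>B\<close> and \<open>B Z = d\<^sub>1 C\<close>, so \<open>C V = 0\<close> forces \<open>Z V = 0\<close>\<close>
    have "?Z * const_mat V = const_mat A * const_mat B * (?Z * const_mat V)"
      unfolding cAB using V by (simp add: left_mult_one_mat[of _ 5 1] mult_carrier_mat[of _ 5 5])
    also have "\<dots> = const_mat A * (const_mat B * ?Z * const_mat V)"
      using A B V by (simp add: assoc_mult_mat[of _ 5 5 _ 5 _ 1] mult_carrier_mat[of _ 5 5])
    also have "const_mat B * ?Z * const_mat V = d 1 * (const_mat C * const_mat V)"
      unfolding dC using d1 C V by (simp add: assoc_mult_mat[of _ 5 5 _ 5 _ 1])
    also have "const_mat C * const_mat V = 0\<^sub>m 5 1"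
      using const.mat_hom_mult[OF C V(1)] V(2) by simp
    also have "const_mat A * (d 1 * 0\<^sub>m 5 1) = 0\<^sub>m 5 1"
      using A d1 by simp
    finally show "V = 0\<^sub>m 5 1"
      using skew_mat_independent[OF \<sigma> V(1)] by simp
  qed
  have cCD: "const_mat C * const_mat D = 1\<^sub>m 5" and cDC: "const_mat D * const_mat C = 1\<^sub>m 5"
    using CD const.mat_hom_mult[OF C D] const.mat_hom_mult[OF D C] by (simp_all add: const.mat_hom_one)
  have dD: "d 1 = const_mat B * ?Z * const_mat D"
  proof -
    have "d 1 = d 1 * (const_mat C * const_mat D)"
      using d1 cCD by simp
    also have "\<dots> = d 1 * const_mat C * const_mat D"
      using d1 C D by (intro assoc3[of _ 5 5 _ 5 _ 5]) simp_all
    finally show ?thesis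
      by (simp only: dC)
  qed

  have Cp: "const_mat C * ?p \<in> carrier_mat 5 1" "homogeneous_mat 2 (const_mat C * ?p)"
    using homogeneous_mat_mult[OF homogeneous_mat_const hom(3), of C, unfolded add_0_left] C
    by (simp_all add: pf_col_def)
  have "d 1 * (const_mat C * ?p) = d 1 * const_mat C * ?p"
    using d1 C by (intro assoc3[of _ 5 5 _ 5 _ 1]) simp_all
  also have "\<dots> = const_mat B * (?Z * ?p)"
    unfolding dC[symmetric] using B by (intro assoc_mult_mat[of _ 5 5 _ 5 _ 1]) simp_all
  also have "\<dots> = 0\<^sub>m 5 1"
    using skew_mat_pf_col[OF char3' skew_zperm[of \<sigma>]] B by simp
  finally have zero1: "d 1 * (const_mat C * ?p) = 0\<^sub>m 5 1" .
  obtain G where G: "G \<in> carrier_mat 1 1" and dG: "const_mat C * ?p = d 2 * const_mat G"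
  proof (rule constant_factor[OF d2 Cp])
    fix j :: nat assume "j < 1"
    then show "col (const_mat C * ?p) j \<in> mat_image (d 2)"
      using col_in_kernel[OF d1(1) Cp(1) zero1] ker[of 1] by (simp add: numeral_2_eq_2)
  qed
  define g where "g = G $$ (0, 0)"
  have "d 2 * const_mat G = const g \<cdot>\<^sub>m d 2"
    using d2 G by (intro eq_matI) (auto simp: scalar_prod_def g_def mult.commute)
  then have dg: "const g \<cdot>\<^sub>m d 2 = const_mat C * ?p"
    using dG by simp
  have "g \<noteq> 0"
  proof
    assume "g = 0"
    have "?p = const_mat D * const_mat C * ?p"
      unfolding cDC by (simp add: left_mult_one_mat[of _ 5 1])
    also have "\<dots> = const_mat D * (const_mat C * ?p)"
      using C D by (intro assoc_mult_mat[of _ 5 5 _ 5 _ 1]) simp_all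
    also have "const_mat C * ?p = 0\<^sub>m 5 1"
      unfolding dg[symmetric] \<open>g = 0\<close> using d2 by (intro eq_matI) auto
    finally have p0: "?p = 0\<^sub>m 5 1"
      using D by simp
    have pf0: "pf ?x (Suc j) = 0" if "j < 5" for j
    proof -
      have "pf ?x (Suc j) = ?p $$ (j, 0)"
        using that by (simp add: pf_col_def)
      then show ?thesis
        using that by (simp add: p0)
    qed
    have "?P * const_mat (1\<^sub>m 5) = 0\<^sub>m 1 5"
      by (rule eq_matI) (simp_all add: pf_row_def scalar_prod_def pf0)
    then have "(1\<^sub>m 5 :: 'k mat) = 0\<^sub>m 5 5"
      by (intro pf_row_independent[OF \<sigma>]) simp_all
    from arg_cong[OF this, of "\<lambda>M. M $$ (0, 0)"] show False by simp
  qed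
  show thesis
    by (rule that[OF A B C D AB CD(2) \<open>g \<noteq> 0\<close> dB[symmetric] dA dC[symmetric] dD dg])
qed

section \<open>The chain map\<close>

theorem theorem7p3:
  fixes d :: "nat \<Rightarrow> 'k::field zpoly mat" and a b c :: nat
  assumes "CHAR('k) = 3"
    and "{a, b, c} = {3, 4, 5}"
    and "minimal_graded_free_resolution pfaffian_ideal pfaffian_twists d"
  shows "\<exists>\<Phi> e.
    graded_chain_map (frobenius_twists 3 pfaffian_twists) (frobenius_diff 3 d)
      pfaffian_twists d \<Phi> \<and>
    \<Phi> 0 = 1\<^sub>m 1 \<and>
    frobenius_mult_wrt 3 e (\<Phi> 3) (H0 a b c)"
proof -
  have char3: "(3::'k) = 0"
    using of_nat_CHAR[where 'a = 'k] assms(1) by simp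
  have char: "(1::'k) \<noteq> -1"
  proof
    assume "(1::'k) = -1"
    then have "(1::'k) + 1 = 0" by (metis add.right_inverse)
    moreover have "(1::'k) + 1 + 1 = 0" using char3 by simp
    ultimately show False by simp
  qed
  note char3' = char3_zpoly[OF char3]
  define \<sigma> where "\<sigma> = as_fun [1, 2, a, b, c]"
  have \<sigma>: "\<sigma> permutes {1..5}"
    unfolding \<sigma>_def using permutation_345(1)[OF assms(2)] by (rule as_fun_permutes)
  let ?x = "zperm \<sigma> :: nat \<Rightarrow> nat \<Rightarrow> 'k zpoly"
  let ?P = "pf_row ?x" and ?Z = "skew_mat ?x" and ?p = "pf_col ?x"
  let ?L1 = "lift1_mat ?x" and ?L2 = "lift2_mat ?x" and ?H = "H0 a b c :: 'k zpoly"
  have H: "?H = value_of ?x poly_H"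
    unfolding \<sigma>_def by (rule H0_value[OF char assms(2)])
  have H_hom: "homogeneous 10 ?H"
    unfolding H by (rule homogeneous_value_of[OF \<sigma> homog_poly_H])
  note hom = standard_homogeneous[OF \<sigma>, where 'k = 'k]
  note std = standard_carrier[of ?x]
  obtain A B C D :: "'k mat" and g :: 'k
    where K: "A \<in> carrier_mat 5 5" "B \<in> carrier_mat 5 5" "C \<in> carrier_mat 5 5" "D \<in> carrier_mat 5 5"
      and AB: "A * B = 1\<^sub>m 5" and DC: "D * C = 1\<^sub>m 5" and g: "g \<noteq> 0"
      and d0B: "d 0 * const_mat B = ?P" and d0: "d 0 = ?P * const_mat A"
      and d1C: "d 1 * const_mat C = const_mat B * ?Z" and d1: "d 1 = const_mat B * ?Z * const_mat D"
      and d2g: "const g \<cdot>\<^sub>m d 2 = const_mat C * ?p"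
    using resolution_comparison[OF char3 \<sigma> assms(3)] by metis
  let ?A = "const_mat A" and ?B = "const_mat B" and ?C = "const_mat C" and ?D = "const_mat D"
  have cK: "?A \<in> carrier_mat 5 5" "?B \<in> carrier_mat 5 5" "?C \<in> carrier_mat 5 5" "?D \<in> carrier_mat 5 5"
    using K by simp_all
  have d2: "d 2 = const (1 / g) \<cdot>\<^sub>m (?C * ?p)"
    unfolding d2g[symmetric] using g
    by (intro eq_matI) (simp_all add: mult.assoc[symmetric] mult_single)
  have gm: "graded_map (pfaffian_twists (Suc n)) (pfaffian_twists n) (d n)" for n
    using assms(3) by (simp add: minimal_graded_free_resolution_def)
  have dc: "d 0 \<in> carrier_mat 1 5" "d 1 \<in> carrier_mat 5 5" "d 2 \<in> carrier_mat 5 1"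
    "d 3 \<in> carrier_mat 1 0"
    using gm[of 0] gm[of 1] gm[of 2] gm[of 3]
    by (simp_all add: graded_map_def pfaffian_twists_def)
  have dn: "d n \<in> carrier_mat 0 0" if "n \<ge> 4" for n
    using gm[of n] that by (simp add: graded_map_def pfaffian_twists_def)
  note cube_mult = cube_mat_mult[OF char3']
  have "?A * ?B = 1\<^sub>m 5" "?D * ?C = 1\<^sub>m 5"
    unfolding const.mat_hom_mult[OF K(1,2), symmetric] const.mat_hom_mult[OF K(4,3), symmetric] AB DC
    by (rule const.mat_hom_one)+
  then have cube_AB: "cube_mat ?A * cube_mat ?B = 1\<^sub>m 5"
    and cube_DC: "cube_mat ?D * cube_mat ?C = 1\<^sub>m 5"
    using cube_mult[OF cK(1,2)] cube_mult[OF cK(4,3)] cube_mat_one[OF char3'] by metis+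

  \<comment> \<open>the chain map \<open>1, L\<^sub>1, L\<^sub>2, H\<^sub>0\<close> transported along \<open>B\<close>, \<open>C\<close> and \<open>g\<close>; beyond degree 3 all modules are zero\<close>
  define \<Phi> where "\<Phi> n =
    (if n = 0 then 1\<^sub>m 1
     else if n = 1 then ?B * ?L1 * cube_mat ?A
     else if n = 2 then ?C * ?L2 * cube_mat ?D
     else if n = 3 then (const (1 / g ^ 2) * ?H) \<cdot>\<^sub>m 1\<^sub>m 1
     else 0\<^sub>m 0 0)" for n :: nat
  have \<Phi>: "\<Phi> 0 = 1\<^sub>m 1" "\<Phi> 1 = ?B * ?L1 * cube_mat ?A" "\<Phi> 2 = ?C * ?L2 * cube_mat ?D"
    "\<Phi> 3 = (const (1 / g ^ 2) * ?H) \<cdot>\<^sub>m 1\<^sub>m 1" "\<And>n. n \<ge> 4 \<Longrightarrow> \<Phi> n = 0\<^sub>m 0 0"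
    by (simp_all add: \<Phi>_def)

  have "graded_map (frobenius_twists 3 pfaffian_twists n) (pfaffian_twists n) (\<Phi> n)" for n
  proof -
    consider "n = 0" | "n = 1" | "n = 2" | "n = 3" | "n \<ge> 4" by linarith
    then show ?thesis
    proof cases
      case 1
      have "homogeneous_mat 0 (1\<^sub>m 1 :: 'k zpoly mat)"
        using homogeneous_mat_const[of "1\<^sub>m 1"] by (simp add: const.mat_hom_one)
      then have "graded_map (replicate 1 0) (replicate 1 0) (1\<^sub>m 1 :: 'k zpoly mat)"
        by (subst graded_map_replicate) simp_all
      then show ?thesis
        by (simp add: 1 \<Phi> frobenius_twists_def pfaffian_twists_def)
    next
      case 2
      have "homogeneous_mat (0 + 4 + 3 * 0) (?B * ?L1 * cube_mat ?A)"
        using cK std by (intro homogeneous_mat_mult homogeneous_mat_const homogeneous_mat_cube hom) auto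
      then have "graded_map (replicate 5 6) (replicate 5 2) (?B * ?L1 * cube_mat ?A)"
        using cK std by (subst graded_map_replicate) auto
      then show ?thesis
        by (simp add: 2 \<Phi>[simplified] frobenius_twists_def pfaffian_twists_def)
    next
      case 3
      have "homogeneous_mat (0 + 6 + 3 * 0) (?C * ?L2 * cube_mat ?D)"
        using cK std by (intro homogeneous_mat_mult homogeneous_mat_const homogeneous_mat_cube hom) auto
      then have "graded_map (replicate 5 9) (replicate 5 3) (?C * ?L2 * cube_mat ?D)"
        using cK std by (subst graded_map_replicate) auto
      then show ?thesis
        by (simp add: 3 \<Phi> frobenius_twists_def pfaffian_twists_def)
    next
      case 4
      have "homogeneous (0 + 10) (const (1 / g ^ 2) * ?H)"
        using H_hom by (intro homogeneous_mult) simp_all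
      then have "graded_map (replicate 1 15) (replicate 1 5) ((const (1 / g ^ 2) * ?H) \<cdot>\<^sub>m 1\<^sub>m 1)"
        by (subst graded_map_replicate) (auto simp: homogeneous_mat_def)
      then show ?thesis
        by (simp add: 4 \<Phi> frobenius_twists_def pfaffian_twists_def)
    next
      case 5
      then show ?thesis
        by (simp add: \<Phi> frobenius_twists_def pfaffian_twists_def graded_map_def)
    qed
  qed
  moreover have "d n * \<Phi> (Suc n) = \<Phi> n * frobenius_diff 3 d n" for n
  proof -
    have fd: "frobenius_diff 3 d n = cube_mat (d n)" for n
      by (simp add: frobenius_diff_def)
    consider "n = 0" | "n = 1" | "n = 2" | "n = 3" | "n \<ge> 4" by linarith
    then show ?thesis
    proof cases
      case 1
      have "d 0 * (?B * ?L1 * cube_mat ?A) = d 0 * ?B * ?L1 * cube_mat ?A"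
        using dc cK std by (simp add: mult_carrier_mat[of _ 5 5] assoc_mult_mat[of _ 1 5 _ 5 _ 5] assoc_mult_mat[of _ 5 5 _ 5 _ 5])
      also have "\<dots> = cube_mat ?P * cube_mat ?A"
        unfolding d0B pf_row_lift1[OF char3' skew_zperm] ..
      also have "\<dots> = cube_mat (d 0)"
        unfolding d0 by (rule cube_mult[OF std(1) cK(1), symmetric])
      finally show ?thesis
        using dc by (simp add: 1 \<Phi>[simplified] fd)
    next
      case 2
      have "d 1 * (?C * ?L2 * cube_mat ?D) = d 1 * ?C * ?L2 * cube_mat ?D"
        using dc cK std by (simp add: mult_carrier_mat[of _ 5 5] assoc_mult_mat[of _ 5 5 _ 5 _ 5])
      also have "\<dots> = ?B * (?Z * ?L2) * cube_mat ?D"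
        unfolding d1C using cK std by (simp add: mult_carrier_mat[of _ 5 5] assoc_mult_mat[of _ 5 5 _ 5 _ 5])
      also have "\<dots> = ?B * (?L1 * cube_mat ?Z) * cube_mat ?D"
        unfolding skew_mat_lift2[OF char3' skew_zperm] ..
      finally have lhs: "d 1 * (?C * ?L2 * cube_mat ?D) = ?B * ?L1 * cube_mat ?Z * cube_mat ?D"
        using cK std by (simp add: mult_carrier_mat[of _ 5 5] assoc_mult_mat[of _ 5 5 _ 5 _ 5])
      have "cube_mat (d 1) = cube_mat ?B * cube_mat ?Z * cube_mat ?D"
        unfolding d1 using cK std by (simp add: cube_mult[of _ 5 5 _ 5])
      then have "?B * ?L1 * cube_mat ?A * cube_mat (d 1) =
          ?B * ?L1 * (cube_mat ?A * cube_mat ?B) * cube_mat ?Z * cube_mat ?D"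
        using cK std by (simp add: mult_carrier_mat[of _ 5 5] assoc_mult_mat[of _ 5 5 _ 5 _ 5])
      then have "?B * ?L1 * cube_mat ?A * cube_mat (d 1) = ?B * ?L1 * cube_mat ?Z * cube_mat ?D"
        unfolding cube_AB using cK std by simp
      then show ?thesis
        using lhs by (simp add: 2 \<Phi>[simplified] fd flip: numeral_2_eq_2)
    next
      case 3
      have "cube_mat (d 2) = const (1 / g ^ 3) \<cdot>\<^sub>m cube_mat (?C * ?p)"
        unfolding d2 by (intro eq_matI) (simp_all add: power_mult_distrib power_one_over flip: const.hom_power)
      also have "cube_mat (?C * ?p) = cube_mat ?C * cube_mat ?p"
        using cK std by (intro cube_mult)
      finally have cube_d2: "cube_mat (d 2) = const (1 / g ^ 3) \<cdot>\<^sub>m (cube_mat ?C * cube_mat ?p)" .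
      have "?C * ?L2 * cube_mat ?D * (cube_mat ?C * cube_mat ?p) =
          ?C * ?L2 * (cube_mat ?D * cube_mat ?C) * cube_mat ?p"
        using cK std by (simp add: mult_carrier_mat[of _ 5 5] assoc_mult_mat[of _ 5 5 _ 5 _ 1] assoc_mult_mat[of _ 5 5 _ 5 _ 5])
      also have "\<dots> = ?C * (?L2 * cube_mat ?p)"
        unfolding cube_DC using cK std by (simp add: mult_carrier_mat[of _ 5 5] assoc_mult_mat[of _ 5 5 _ 5 _ 1])
      also have "\<dots> = ?H \<cdot>\<^sub>m (?C * ?p)"
        unfolding lift2_pf_col[OF char3' skew_zperm] H using cK std by (intro mult_smult_distrib)
      finally have "?C * ?L2 * cube_mat ?D * cube_mat (d 2) = const (1 / g ^ 3) \<cdot>\<^sub>m (?H \<cdot>\<^sub>m (?C * ?p))"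
        unfolding cube_d2 using cK std
        by (subst mult_smult_distrib[of _ 5 5 _ 1]) auto
      moreover have "d 2 * ((const (1 / g ^ 2) * ?H) \<cdot>\<^sub>m 1\<^sub>m 1) = (const (1 / g ^ 2) * ?H) \<cdot>\<^sub>m d 2"
        using dc by (subst mult_smult_distrib[of _ 5 1 _ 1]) auto
      moreover have "(const (1 / g ^ 2) * ?H) \<cdot>\<^sub>m d 2 = const (1 / g ^ 3) \<cdot>\<^sub>m (?H \<cdot>\<^sub>m (?C * ?p))"
      proof -
        have g3: "const (1 / g ^ 3) = const (1 / g ^ 2) * const (1 / g)"
          by (simp add: mult_single power2_eq_square power3_eq_cube)
        have "const (1 / g ^ 2) * ?H * (const (1 / g) * f) = const (1 / g ^ 3) * (?H * f)" for f
          unfolding g3 by (simp only: mult_ac)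
        then show ?thesis
          unfolding d2 by (intro eq_matI) simp_all
      qed
      ultimately show ?thesis
        by (simp add: 3 \<Phi>[simplified] fd)
    next
      case 4
      then show ?thesis
        using dc(4) by (intro eq_matI) (auto simp: \<Phi> fd)
    next
      case 5
      then show ?thesis
        using dn[of n] by (intro eq_matI) (auto simp: \<Phi> fd)
    qed
  qed
  ultimately have "graded_chain_map (frobenius_twists 3 pfaffian_twists) (frobenius_diff 3 d)
      pfaffian_twists d \<Phi>"
    by (simp add: graded_chain_map_def)
  \<comment> \<open>the basis \<open>e = g\<close> absorbs the factor \<open>g\<^sup>-\<^sup>2\<close>\<close>
  moreover have "frobenius_mult_wrt 3 (const g) (\<Phi> 3) ?H"
  proof -
    have "1 = const g * const (1 / g)"
      using g by (simp add: mult_single)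
    then have unit: "const g dvd 1"
      by (rule dvdI)
    have g1: "const g = const (1 / g ^ 2) * const g ^ 3"
      using g by (simp add: mult_single power2_eq_square power3_eq_cube)
    have "const (1 / g ^ 2) * ?H * const g ^ 3 = ?H * (const (1 / g ^ 2) * const g ^ 3)"
      by (simp only: mult_ac)
    then have "const (1 / g ^ 2) * ?H * const g ^ 3 = ?H * const g"
      using g1 by simp
    then have "\<Phi> 3 *\<^sub>v vec_of_list [const g ^ 3] = ?H \<cdot>\<^sub>v vec_of_list [const g]"
      by (intro eq_vecI) (simp_all add: \<Phi> scalar_prod_def)
    then show ?thesis
      using unit by (simp add: frobenius_mult_wrt_def)
  qed
  ultimately show ?thesis
    using \<Phi>(1) by blast
qed

end
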